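(* Let $G$ be the complete graph on three vertices and $$\Lambda_G(f_1,f_2,f_3)=\int_{(\mathbb R^2)^3}\sigma(x_1-x_2)\sigma(x_1-x_3)\sigma(x_2-x_3)f_1(x_1)f_2(x_2)f_3(x_3)$$ (defined as in the context). Then $\Lambda_G(f_1,f_2,f_3)\le C\|f_1\|_{L^{p_1}(\mathbb R^2)}\|f_2\|_{L^{p_2}(\mathbb R^2)}\|f_3\|_{L^{p_3}(\mathbb R^2)}$ for all $(\frac1{p_1},\frac1{p_2},\frac1{p_3})$ in the closed polygon with vertices $$(1,0,0),\ (0,1,0),\ (0,0,1),\ (\tfrac23,\tfrac23,0),\ (\tfrac23,0,\tfrac23),\ (0,\tfrac23,\tfrac23),\ (\tfrac12,\tfrac12,\tfrac12),$$ except that at the endpoint $(\frac12,\frac12,\frac12)$ only a restricted strong-type estimate holds. These exponents are optimal: no such bound holds for $(\frac1{p_1},\frac1{p_2},\frac1{p_3})$ outside this polygon.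
   Context: $\sigma$ is arc-length measure on the unit circle in $\mathbb R^2$. The form is defined as $\lim_{\epsilon\to0}\int\prod_{\{i,j\}}\sigma_\epsilon(x_i-x_j)\prod_if_i(x_i)\,dx$ with $\sigma_\epsilon(z)=(2\epsilon)^{-1}\chi_{[-1,1]}(\epsilon^{-1}(|z|-1))$, for nonnegative measurable $f_i$. A restricted strong-type estimate means the bound holds when each $f_i$ is the indicator function of a measurable set of finite measure.
   Formalization: At (1/2,1/2,1/2) the restricted strong-type estimate is stated, but "only" is not read as failure of the strong-type bound (which in fact holds there); exponents outside the polygon range over 1 ≤ p_i ≤ ∞. *)

theory Defs
  imports "HOL-Analysis.Analysis" "HOL-Probability.Essential_Supremum"
begin

text \<open>Regularized arc-length measure on the unit circle in the plane:
  sigma_eps(z) = (2 eps)^(-1) chi_[-1,1]((|z|-1)/eps).\<close>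
definition sigma_eps :: "real \<Rightarrow> real^2 \<Rightarrow> ennreal" where
  "sigma_eps \<epsilon> z = (if \<bar>norm z - 1\<bar> \<le> \<epsilon> then ennreal (1 / (2 * \<epsilon>)) else 0)"

text \<open>The regularized triangle form over (R^2)^3 (iterated Lebesgue integral of a
  nonnegative function; equal to the product integral by Tonelli).\<close>
definition Lambda_eps ::
  "real \<Rightarrow> (real^2 \<Rightarrow> real) \<Rightarrow> (real^2 \<Rightarrow> real) \<Rightarrow> (real^2 \<Rightarrow> real) \<Rightarrow> ennreal" where
  "Lambda_eps \<epsilon> f1 f2 f3 =
     (\<integral>\<^sup>+ x1. \<integral>\<^sup>+ x2. \<integral>\<^sup>+ x3.
        sigma_eps \<epsilon> (x1 - x2) * sigma_eps \<epsilon> (x1 - x3) * sigma_eps \<epsilon> (x2 - x3)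
        * ennreal (f1 x1) * ennreal (f2 x2) * ennreal (f3 x3) \<partial>lebesgue \<partial>lebesgue \<partial>lebesgue)"

text \<open>Lambda_G is defined as the limit eps -> 0+.  We use limsup for upper bounds and
  liminf for lower bounds (both coincide with the limit whenever it exists).\<close>
definition Lambda_sup :: "(real^2 \<Rightarrow> real) \<Rightarrow> (real^2 \<Rightarrow> real) \<Rightarrow> (real^2 \<Rightarrow> real) \<Rightarrow> ennreal" where
  "Lambda_sup f1 f2 f3 = Limsup (at_right 0) (\<lambda>\<epsilon>. Lambda_eps \<epsilon> f1 f2 f3)"

definition Lambda_inf :: "(real^2 \<Rightarrow> real) \<Rightarrow> (real^2 \<Rightarrow> real) \<Rightarrow> (real^2 \<Rightarrow> real) \<Rightarrow> ennreal" where
  "Lambda_inf f1 f2 f3 = Liminf (at_right 0) (\<lambda>\<epsilon>. Lambda_eps \<epsilon> f1 f2 f3)"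

definition enn_powr :: "ennreal \<Rightarrow> real \<Rightarrow> ennreal" where
  "enn_powr a t = (if a = \<infinity> then \<infinity> else ennreal (enn2real a powr t))"

text \<open>L^p norm of a nonnegative function on R^2, parametrized by t = 1/p in [0,1];
  t = 0 corresponds to p = infinity (essential supremum).\<close>
definition Lp_norm :: "real \<Rightarrow> (real^2 \<Rightarrow> real) \<Rightarrow> ennreal" where
  "Lp_norm t f = (if t = 0 then esssup lebesgue (\<lambda>x. ennreal (f x))
                  else enn_powr (\<integral>\<^sup>+ x. ennreal (f x powr (1 / t)) \<partial>lebesgue) t)"

definition triangle_polytope :: "(real \<times> real \<times> real) set" where
  "triangle_polytope = convex hull {(1,0,0), (0,1,0), (0,0,1),
      (2/3,2/3,0), (2/3,0,2/3), (0,2/3,2/3), (1/2,1/2,1/2)}"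

definition nonneg_meas :: "(real^2 \<Rightarrow> real) \<Rightarrow> bool" where
  "nonneg_meas f \<longleftrightarrow> f \<in> borel_measurable lebesgue \<and> (\<forall>x. 0 \<le> f x)"

end

theory Submission
  imports Defs
begin

text \<open>
  All bounds are proved for \<open>sigma_eps \<epsilon>\<close> uniformly in small \<open>\<epsilon>\<close>. The basic estimate is that
  \<open>|det2 (x - y1) (x - y2)|\<close>, integrated in \<open>x\<close> against the two annuli around \<open>y1\<close> and \<open>y2\<close>, is bounded,
  because this determinant is the Jacobian of \<open>x \<mapsto> (|x - y1|, |x - y2|)\<close> up to bounded factors; on an
  almost equilateral triangle it is at least 1/2.

  At \<open>(1/2, 1/2, 1/2)\<close>, Cauchy-Schwarz in the third function leaves the square of a bilinear operator, i.e.
  an integral over two triangles with a common vertex. The Pluecker relation bounds the product of their two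
  determinants by products of determinants that mix the triangles, and each of these is integrated by the basic
  estimate. At \<open>(2/3, 2/3, 0)\<close> the third vertex is integrated out and the problem is the
  \<open>L^{3/2} \<rightarrow> L^3\<close> bound for circular means; its cube is a trilinear form whose integrand is
  distributed over the three pairs of points by weights with product at least 1. Since the form is positive, the set
  of admissible exponents is convex, so the vertices give the whole polytope.

  For the converse, the indicators of the ball of radius \<open>r\<close> and of the annulus \<open>||y| - 1| \<le> 2r\<close>, for
  \<open>r \<rightarrow> \<infinity>\<close> and \<open>r \<rightarrow> 0\<close>, force the facet inequalities
  \<open>t1 + t2 + t3 \<ge> 1\<close> and \<open>ti + (t1 + t2 + t3) \<le> 2\<close>.
\<close>

section \<open>The Jacobian in the coordinates of inner products\<close>

text \<open>The obstacle is tangency. The Jacobian vanishes where the two circles touch, and without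
  it the integral of two annuli is not bounded uniformly in their centres and \<epsilon>. A point
  may therefore be integrated against two annuli only in the presence of the determinant, and each
  vertex of the polytope needs its own device to create that factor: an almost equilateral triangle
  supplies it directly, the Pluecker relation supplies it for two triangles, and the dyadic weights
  supply it for three points on one circle. Norms are normalized to at most 1 before anything is
  estimated. Hoelder's inequality then becomes a pointwise comparison of a product with a sum (a b
  with a^2 + b^2, a^2 b with a^3 + b^3, x^u y^v with x + y), and homogeneity is restored by scaling
  at the end. Since the passage to convex combinations is also pointwise, every vertex has to carry
  a genuine strong-type bound; this includes (1/2, 1/2, 1/2), where the restricted estimate is read
  off from the strong one.\<close>

definition det2 :: "real^2 \<Rightarrow> real^2 \<Rightarrow> real" where
  "det2 u v = u$1 * v$2 - u$2 * v$1"

lemma inner_vec2: "(u::real^2) \<bullet> v = u$1 * v$1 + u$2 * v$2"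
  by (simp add: inner_vec_def UNIV_2)

lemma borel_measurable_vec_nth [measurable (raw)]:
  fixes f :: "'a \<Rightarrow> real^'n"
  assumes "f \<in> borel_measurable M"
  shows "(\<lambda>x. f x $ i) \<in> borel_measurable M"
  by (rule borel_measurable_continuous_on[OF _ assms]) (intro continuous_intros)

lemma borel_measurable_det2 [measurable (raw)]:
  assumes [measurable]: "f \<in> borel_measurable M" "g \<in> borel_measurable M"
  shows "(\<lambda>x. det2 (f x) (g x)) \<in> borel_measurable M"
  unfolding det2_def by measurable

lemma borel_measurable_vector2 [measurable (raw)]:
  assumes [measurable]: "f \<in> borel_measurable M" "g \<in> borel_measurable M"
  shows "(\<lambda>x. vector [f x, g x] :: real^2) \<in> borel_measurable M"
proof -
  have eq: "(\<lambda>x. vector [f x, g x] :: real^2) = (\<lambda>x. f x *\<^sub>R axis 1 1 + g x *\<^sub>R axis 2 1)"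
    by (rule ext) (simp add: vec_eq_iff forall_2 axis_def)
  show ?thesis unfolding eq by measurable
qed

text \<open>Lebesgue measure is determined by its values on boxes. Since \<open>real^2\<close> is
  not a product type, this is the bridge from plane integrals to iterated integrals over the two
  components.\<close>

lemma lborel_vec2:
  "(lborel :: (real^2) measure) = distr (lborel \<Otimes>\<^sub>M lborel) borel (\<lambda>(a, b). vector [a, b])"
proof (rule lborel_eqI)
  fix l u :: "real^2"
  assume lu: "\<And>b. b \<in> Basis \<Longrightarrow> l \<bullet> b \<le> u \<bullet> b"
  have B: "(Basis :: (real^2) set) = {axis 1 1, axis 2 1}"
    by (auto simp: Basis_vec_def UNIV_2)
  have ne: "axis 1 1 \<noteq> (axis 2 1 :: real^2)"
    by (simp add: axis_eq_axis)
  have le: "l$1 \<le> u$1" "l$2 \<le> u$2"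
    using lu[of "axis 1 1"] lu[of "axis 2 1"] by (simp_all add: B inner_axis)
  have pre: "(\<lambda>(a, b). vector [a, b] :: real^2) -` box l u \<inter> space (lborel \<Otimes>\<^sub>M lborel)
      = {l$1<..<u$1} \<times> {l$2<..<u$2}"
    by (auto simp: mem_box_cart forall_2 space_pair_measure)
  have "emeasure (distr (lborel \<Otimes>\<^sub>M lborel) borel (\<lambda>(a, b). vector [a, b])) (box l u)
      = emeasure (lborel \<Otimes>\<^sub>M lborel) ({l$1<..<u$1} \<times> {l$2<..<u$2})"
    by (subst emeasure_distr) (simp_all only: pre, measurable)
  also have "\<dots> = ennreal (u$1 - l$1) * ennreal (u$2 - l$2)"
    using le by (subst lborel.emeasure_pair_measure_Times) auto
  also have "\<dots> = (\<Prod>b\<in>Basis. (u - l) \<bullet> b)"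
    using le ne by (simp add: B inner_axis ennreal_mult)
  finally show "emeasure (distr (lborel \<Otimes>\<^sub>M lborel) borel (\<lambda>(a, b). vector [a, b])) (box l u)
      = (\<Prod>b\<in>Basis. (u - l) \<bullet> b)" .
qed simp

lemma nn_integral_vec2:
  fixes F :: "real^2 \<Rightarrow> ennreal"
  assumes [measurable]: "F \<in> borel_measurable borel"
  shows "(\<integral>\<^sup>+z. F z \<partial>lborel) = (\<integral>\<^sup>+a. \<integral>\<^sup>+b. F (vector [a, b]) \<partial>lborel \<partial>lborel)"
    and "(\<integral>\<^sup>+z. F z \<partial>lborel) = (\<integral>\<^sup>+b. \<integral>\<^sup>+a. F (vector [a, b]) \<partial>lborel \<partial>lborel)"
proof -
  have "(\<integral>\<^sup>+z. F z \<partial>lborel) = (\<integral>\<^sup>+p. F (vector [fst p, snd p]) \<partial>(lborel \<Otimes>\<^sub>M lborel))"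
    by (subst lborel_vec2, subst nn_integral_distr) (auto simp: case_prod_beta)
  also have "\<dots> = (\<integral>\<^sup>+a. \<integral>\<^sup>+b. F (vector [a, b]) \<partial>lborel \<partial>lborel)"
    by (subst lborel.nn_integral_fst[symmetric]) simp_all
  finally show *: "(\<integral>\<^sup>+z. F z \<partial>lborel) = (\<integral>\<^sup>+a. \<integral>\<^sup>+b. F (vector [a, b]) \<partial>lborel \<partial>lborel)" .
  show "(\<integral>\<^sup>+z. F z \<partial>lborel) = (\<integral>\<^sup>+b. \<integral>\<^sup>+a. F (vector [a, b]) \<partial>lborel \<partial>lborel)"
    unfolding * by (rule lborel_pair.Fubini') measurable
qed

lemma nn_integral_lborel_plus:
  fixes F :: "'a::euclidean_space \<Rightarrow> ennreal"
  assumes [measurable]: "F \<in> borel_measurable borel"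
  shows "(\<integral>\<^sup>+z. F (c + z) \<partial>lborel) = (\<integral>\<^sup>+z. F z \<partial>lborel)"
  by (subst (2) lborel_distr_plus[of c, symmetric], subst nn_integral_distr) auto

text \<open>Under \<open>s = \<alpha> * r^2 + \<gamma>\<close> the density becomes half of
  \<open>ds\<close> on each half-line, and the two halves together see at most the length of
  \<open>{l..h}\<close>.\<close>

lemma nn_integral_abs_times_indicator_quadratic_le:
  fixes \<alpha> \<gamma> l h :: real
  assumes "\<alpha> > 0" "l \<le> h"
  shows "(\<integral>\<^sup>+r. ennreal (\<alpha> * \<bar>r\<bar>) * indicator {l..h} (\<alpha> * r\<^sup>2 + \<gamma>) \<partial>lborel) \<le> ennreal (h - l)"
proof -
  \<comment> \<open>The admissible values of \<open>\<bar>r\<bar>\<close> lie in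
    \<open>{a..b}\<close>; the truncation at 0 covers a quadratic whose minimum \<gamma> already
    exceeds \<open>l\<close> or \<open>h\<close>.\<close>
  define a where "a = sqrt (max 0 ((l - \<gamma>) / \<alpha>))"
  define b where "b = sqrt (max 0 ((h - \<gamma>) / \<alpha>))"
  have "(l - \<gamma>) / \<alpha> \<le> (h - \<gamma>) / \<alpha>" using assms by (simp add: divide_right_mono)
  then have ab: "a \<le> b" "0 \<le> a" by (auto simp: a_def b_def)
  have len: "\<alpha> * b\<^sup>2 - \<alpha> * a\<^sup>2 \<le> h - l"
  proof -
    have "b\<^sup>2 = max 0 ((h - \<gamma>) / \<alpha>)" "a\<^sup>2 = max 0 ((l - \<gamma>) / \<alpha>)" by (auto simp: a_def b_def)
    then have "b\<^sup>2 - a\<^sup>2 \<le> (h - \<gamma>) / \<alpha> - (l - \<gamma>) / \<alpha>"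
      using \<open>(l - \<gamma>) / \<alpha> \<le> (h - \<gamma>) / \<alpha>\<close> by auto
    then have "\<alpha> * (b\<^sup>2 - a\<^sup>2) \<le> \<alpha> * ((h - \<gamma>) / \<alpha> - (l - \<gamma>) / \<alpha>)"
      using assms by (intro mult_left_mono) auto
    also have "\<dots> = h - l" using assms by (simp add: field_simps)
    finally show ?thesis by (simp add: algebra_simps)
  qed
  have pt: "ennreal (\<alpha> * \<bar>r\<bar>) * indicator {l..h} (\<alpha> * r\<^sup>2 + \<gamma>)
      \<le> ennreal (\<alpha> * r) * indicator {a..b} r + ennreal (- (\<alpha> * r)) * indicator {-b..-a} r" for r
  proof (cases "\<alpha> * r\<^sup>2 + \<gamma> \<in> {l..h}")
    case True
    then have "(l - \<gamma>) / \<alpha> \<le> \<bar>r\<bar>\<^sup>2" "\<bar>r\<bar>\<^sup>2 \<le> (h - \<gamma>) / \<alpha>" using assms by (auto simp: field_simps)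
    then have "a \<le> \<bar>r\<bar>" "\<bar>r\<bar> \<le> b"
      unfolding a_def b_def by (auto intro!: real_le_lsqrt real_le_rsqrt)
    then show ?thesis using True by (cases "r \<ge> 0") (auto simp: indicator_def)
  qed simp
  have 1: "(\<integral>\<^sup>+r. ennreal (\<alpha> * r) * indicator {a..b} r \<partial>lborel)
      = ennreal (\<alpha> * b\<^sup>2 / 2 - \<alpha> * a\<^sup>2 / 2)"
    by (rule nn_integral_FTC_Icc[where F = "\<lambda>r. \<alpha> * r\<^sup>2 / 2"])
       (use assms ab in \<open>auto intro!: derivative_eq_intros simp: power2_eq_square\<close>)
  have 2: "(\<integral>\<^sup>+r. ennreal (- (\<alpha> * r)) * indicator {-b..-a} r \<partial>lborel)
      = ennreal (- (\<alpha> * (-a)\<^sup>2 / 2) - (- (\<alpha> * (-b)\<^sup>2 / 2)))"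
    by (rule nn_integral_FTC_Icc[where F = "\<lambda>r. - (\<alpha> * r\<^sup>2 / 2)"])
       (use assms ab in \<open>auto intro!: derivative_eq_intros simp: power2_eq_square mult_nonneg_nonpos\<close>)
  have sq: "a\<^sup>2 \<le> b\<^sup>2" using ab by (simp add: power_mono)
  have "(\<integral>\<^sup>+r. ennreal (\<alpha> * \<bar>r\<bar>) * indicator {l..h} (\<alpha> * r\<^sup>2 + \<gamma>) \<partial>lborel)
      \<le> (\<integral>\<^sup>+r. ennreal (\<alpha> * r) * indicator {a..b} r + ennreal (- (\<alpha> * r)) * indicator {-b..-a} r \<partial>lborel)"
    by (rule nn_integral_mono) (rule pt)
  also have "\<dots> = ennreal (\<alpha> * b\<^sup>2 / 2 - \<alpha> * a\<^sup>2 / 2) + ennreal (\<alpha> * b\<^sup>2 / 2 - \<alpha> * a\<^sup>2 / 2)"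
    by (subst nn_integral_add) (simp_all add: 1 2)
  also have "\<dots> = ennreal (\<alpha> * b\<^sup>2 - \<alpha> * a\<^sup>2)"
    using assms sq by (subst ennreal_plus[symmetric]) (auto intro!: divide_right_mono mult_left_mono)
  also have "\<dots> \<le> ennreal (h - l)" using len by (rule ennreal_leI)
  finally show ?thesis .
qed

text \<open>In the coordinates \<open>z \<bullet> w\<close>, \<open>z \<bullet> z\<close> the area element is \<open>|det2 z w| dz\<close> up to a factor 2,
  which is compensated by the two-to-oneness of the coordinate map.\<close>
lemma nn_integral_det2_strip_annulus_le_aux:
  fixes w :: "real^2"
  assumes w: "w$1 \<noteq> 0" and "p \<le> q" "l \<le> h"
  shows "(\<integral>\<^sup>+z. ennreal \<bar>det2 z w\<bar> * indicator {p..q} (z \<bullet> w) * indicator {l..h} (z \<bullet> z) \<partial>lborel)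
      \<le> ennreal ((q - p) * (h - l))"
proof -
  define n where "n = w \<bullet> w"
  have n: "n = (w$1)\<^sup>2 + (w$2)\<^sup>2" by (simp add: n_def inner_vec2 power2_eq_square)
  have n0: "n > 0" using w by (simp add: n sum_power2_gt_zero_iff)
  define \<alpha> where "\<alpha> = n / (w$1)\<^sup>2"
  have \<alpha>: "\<alpha> > 0" using n0 w by (simp add: \<alpha>_def)
  \<comment> \<open>\<open>v s b\<close> is the point with second component \<open>b\<close> on the
    line of points whose inner product with \<open>w\<close> is \<open>s\<close>; the change from
    first component to \<open>s\<close> costs the factor \<open>1 / w$1\<close>.\<close>
  define v where "v s b = (vector [- b * w$2 / w$1 + s / w$1, b] :: real^2)" for s b
  have [measurable]: "(\<lambda>x. v (f x) (g x)) \<in> borel_measurable M"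
    if "f \<in> borel_measurable M" "g \<in> borel_measurable M" for f g and M :: "'b measure"
    using that unfolding v_def by measurable
  define G where "G s b = ennreal (\<bar>1 / w$1\<bar> * \<bar>det2 (v s b) w\<bar>) * indicator {p..q} s
      * indicator {l..h} (v s b \<bullet> v s b)" for s b
  have [measurable]: "(\<lambda>x. G (f x) (g x)) \<in> borel_measurable M"
    if [measurable]: "f \<in> borel_measurable M" "g \<in> borel_measurable M" for f g and M :: "'b measure"
    unfolding G_def by measurable
  have v_w: "v s b \<bullet> w = s" for s b using w by (simp add: v_def inner_vec2 field_simps)
  have "(\<integral>\<^sup>+z. ennreal \<bar>det2 z w\<bar> * indicator {p..q} (z \<bullet> w) * indicator {l..h} (z \<bullet> z) \<partial>lborel)
     = (\<integral>\<^sup>+b. \<integral>\<^sup>+s. G s b \<partial>lborel \<partial>lborel)"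
  proof (subst nn_integral_vec2(2), measurable, rule nn_integral_cong)
    fix b :: real
    have "(\<integral>\<^sup>+a. ennreal \<bar>det2 (vector [a, b]) w\<bar> * indicator {p..q} (vector [a, b] \<bullet> w) *
        indicator {l..h} (vector [a, b] \<bullet> (vector [a, b] :: real^2)) \<partial>lborel)
      = ennreal \<bar>1 / w$1\<bar> * (\<integral>\<^sup>+s. ennreal \<bar>det2 (v s b) w\<bar> * indicator {p..q} (v s b \<bullet> w) *
        indicator {l..h} (v s b \<bullet> v s b) \<partial>lborel)"
      by (subst nn_integral_real_affine[where c = "1 / w$1" and t = "- b * w$2 / w$1"])
         (use w in \<open>simp_all add: v_def\<close>)
    also have "\<dots> = (\<integral>\<^sup>+s. G s b \<partial>lborel)"
      by (subst nn_integral_cmult[symmetric], measurable)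
         (simp only: G_def v_w ennreal_mult[OF abs_ge_zero abs_ge_zero] mult.assoc)
    finally show "(\<integral>\<^sup>+a. ennreal \<bar>det2 (vector [a, b]) w\<bar> * indicator {p..q} (vector [a, b] \<bullet> w) *
        indicator {l..h} (vector [a, b] \<bullet> (vector [a, b] :: real^2)) \<partial>lborel) = (\<integral>\<^sup>+s. G s b \<partial>lborel)" .
  qed
  also have "\<dots> = (\<integral>\<^sup>+s. \<integral>\<^sup>+b. G s b \<partial>lborel \<partial>lborel)"
    by (rule lborel_pair.Fubini') measurable
  also have "\<dots> \<le> (\<integral>\<^sup>+s. ennreal (h - l) * indicator {p..q} s \<partial>lborel)"
  proof (rule nn_integral_mono)
    fix s :: real
    \<comment> \<open>The shift by \<open>s * w$2 / n\<close> puts \<open>r = 0\<close> at the foot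
      of the perpendicular from the origin to the line. Hence no term linear in \<open>r\<close>
      survives in the squared norm, and the determinant is proportional to \<open>r\<close>.\<close>
    have det: "\<bar>1 / w$1\<bar> * \<bar>det2 (v s (s * w$2 / n + r)) w\<bar> = \<alpha> * \<bar>r\<bar>" for r
    proof -
      have "det2 (v s (s * w$2 / n + r)) w = - (n * r / w$1)"
        using w n0 unfolding n by (simp add: v_def det2_def divide_simps) algebra
      then show ?thesis
        using n0 by (simp add: \<alpha>_def abs_mult power2_eq_square)
    qed
    have nrm: "v s (s * w$2 / n + r) \<bullet> v s (s * w$2 / n + r) = \<alpha> * r\<^sup>2 + s\<^sup>2 / n" for r
      using w n0 unfolding n \<alpha>_def by (simp add: v_def inner_vec2 divide_simps) algebra
    have "(\<integral>\<^sup>+b. G s b \<partial>lborel) = (\<integral>\<^sup>+r. G s (s * w$2 / n + r) \<partial>lborel)"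
      by (rule nn_integral_lborel_plus[symmetric]) measurable
    also have "\<dots> = (\<integral>\<^sup>+r. indicator {p..q} s *
        (ennreal (\<alpha> * \<bar>r\<bar>) * indicator {l..h} (\<alpha> * r\<^sup>2 + s\<^sup>2 / n)) \<partial>lborel)"
      by (simp only: G_def det nrm mult_ac)
    also have "\<dots> = indicator {p..q} s *
        (\<integral>\<^sup>+r. ennreal (\<alpha> * \<bar>r\<bar>) * indicator {l..h} (\<alpha> * r\<^sup>2 + s\<^sup>2 / n) \<partial>lborel)"
      by (rule nn_integral_cmult) measurable
    also have "\<dots> \<le> indicator {p..q} s * ennreal (h - l)"
      using nn_integral_abs_times_indicator_quadratic_le[OF \<alpha> \<open>l \<le> h\<close>] by (rule mult_left_mono) simp
    finally show "(\<integral>\<^sup>+b. G s b \<partial>lborel) \<le> ennreal (h - l) * indicator {p..q} s"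
      by (simp add: mult.commute)
  qed
  also have "\<dots> = ennreal ((q - p) * (h - l))"
    using assms by (subst nn_integral_cmult) (auto simp: ennreal_mult mult.commute)
  finally show ?thesis .
qed

lemma nn_integral_det2_strip_annulus_le:
  fixes w :: "real^2"
  assumes "p \<le> q" "l \<le> h"
  shows "(\<integral>\<^sup>+z. ennreal \<bar>det2 z w\<bar> * indicator {p..q} (z \<bullet> w) * indicator {l..h} (z \<bullet> z) \<partial>lborel)
      \<le> ennreal ((q - p) * (h - l))"
proof (cases "w$1 = 0")
  case True
  show ?thesis
  proof (cases "w$2 = 0")
    case True
    with \<open>w$1 = 0\<close> show ?thesis by (simp add: det2_def)
  next
    case False
    \<comment> \<open>Reflection in the diagonal preserves area, inner products and the modulus of
      the determinant, and makes the first component of \<open>w\<close> nonzero.\<close>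
    define w' where "w' = (vector [w$2, w$1] :: real^2)"
    have "(\<integral>\<^sup>+z. ennreal \<bar>det2 z w\<bar> * indicator {p..q} (z \<bullet> w) * indicator {l..h} (z \<bullet> z) \<partial>lborel)
      = (\<integral>\<^sup>+z. ennreal \<bar>det2 z w'\<bar> * indicator {p..q} (z \<bullet> w') * indicator {l..h} (z \<bullet> z) \<partial>lborel)"
      by (subst nn_integral_vec2(1), measurable, subst nn_integral_vec2(2), measurable)
         (auto intro!: nn_integral_cong arg_cong2[of _ _ _ _ "(*)"] simp: w'_def det2_def inner_vec2 algebra_simps)
    also have "\<dots> \<le> ennreal ((q - p) * (h - l))"
      by (rule nn_integral_det2_strip_annulus_le_aux) (use False assms in \<open>auto simp: w'_def\<close>)
    finally show ?thesis .
  qed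
qed (use assms in \<open>auto intro: nn_integral_det2_strip_annulus_le_aux\<close>)

section \<open>Integrals over thin annuli\<close>

lemma lagrange_det2: "(det2 u v)\<^sup>2 + (u \<bullet> v)\<^sup>2 = (u \<bullet> u) * (v \<bullet> v)"
  unfolding det2_def inner_vec2 by algebra

lemma abs_det2_le: "\<bar>det2 u v\<bar> \<le> norm u * norm v"
proof -
  have "(det2 u v)\<^sup>2 \<le> (norm u * norm v)\<^sup>2"
    using lagrange_det2[of u v] zero_le_power2[of "u \<bullet> v"]
    unfolding power_mult_distrib power2_norm_eq_inner by linarith
  then show ?thesis unfolding abs_le_square_iff[symmetric] by (simp add: abs_mult)
qed

lemma det2_minus [simp]: "det2 (- u) v = - det2 u v" "det2 u (- v) = - det2 u v"
  by (simp_all add: det2_def)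

lemma det2_commute: "det2 u v = - det2 v u"
  by (simp add: det2_def)

lemma borel_measurable_sigma_eps [measurable (raw)]:
  assumes [measurable]: "f \<in> borel_measurable M"
  shows "(\<lambda>x. sigma_eps \<epsilon> (f x)) \<in> borel_measurable M"
  unfolding sigma_eps_def by measurable

lemma sigma_eps_minus_commute: "sigma_eps \<epsilon> (x - y) = sigma_eps \<epsilon> (y - x)"
  by (simp add: sigma_eps_def norm_minus_commute)

lemma emeasure_annulus:
  fixes c :: "real^2"
  assumes "0 < \<delta>" "\<delta> \<le> 1"
  shows "emeasure lborel {z. \<bar>norm (z - c) - 1\<bar> \<le> \<delta>} = ennreal (4 * pi * \<delta>)"
proof -
  have set: "{z. \<bar>norm (z - c) - 1\<bar> \<le> \<delta>} = cball c (1 + \<delta>) - ball c (1 - \<delta>)"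
    by (auto simp: dist_norm norm_minus_commute)
  have "emeasure lborel {z. \<bar>norm (z - c) - 1\<bar> \<le> \<delta>}
      = emeasure lborel (cball c (1 + \<delta>)) - emeasure lborel (ball c (1 - \<delta>))"
    unfolding set using assms emeasure_lborel_ball_finite[of c "1 - \<delta>"]
    by (subst emeasure_Diff) auto
  also have "\<dots> = ennreal (pi * (1 + \<delta>)\<^sup>2 - pi * (1 - \<delta>)\<^sup>2)"
    using assms by (simp add: emeasure_cball emeasure_ball unit_ball_vol_2 ennreal_minus)
  also have "pi * (1 + \<delta>)\<^sup>2 - pi * (1 - \<delta>)\<^sup>2 = 4 * pi * \<delta>"
    by (simp add: power2_eq_square algebra_simps)
  finally show ?thesis .
qed

text \<open>The threshold 1/20 is chosen so that three mutual distances within \<epsilon> of 1 force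
  a triangle whose determinant is at least 1/2.\<close>

locale thin_annulus =
  fixes \<epsilon> :: real
  assumes eps_pos: "0 < \<epsilon>" and eps_le: "\<epsilon> \<le> 1/20"
begin

abbreviation \<sigma> :: "real^2 \<Rightarrow> ennreal" where "\<sigma> \<equiv> sigma_eps \<epsilon>"

lemma sigma_norm_bounds:
  assumes "\<sigma> z \<noteq> 0"
  shows "19/20 \<le> norm z" "norm z \<le> 21/20"
  using assms eps_le by (auto simp: sigma_eps_def abs_le_iff split: if_splits)

text \<open>The squared norm is the coordinate in which the area element was computed, and in it the
  annulus is an interval of length \<open>4 * \<epsilon>\<close>.\<close>

lemma sigma_eq_indicator:
  "\<sigma> z = ennreal (1 / (2 * \<epsilon>)) * indicator {(1 - \<epsilon>)\<^sup>2..(1 + \<epsilon>)\<^sup>2} (z \<bullet> z)"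
proof -
  have "\<bar>norm z - 1\<bar> \<le> \<epsilon> \<longleftrightarrow> 1 - \<epsilon> \<le> norm z \<and> norm z \<le> 1 + \<epsilon>" by auto
  also have "\<dots> \<longleftrightarrow> (1 - \<epsilon>)\<^sup>2 \<le> (norm z)\<^sup>2 \<and> (norm z)\<^sup>2 \<le> (1 + \<epsilon>)\<^sup>2"
    using eps_pos eps_le by (simp add: power_mono_iff)
  finally show ?thesis
    by (auto simp: sigma_eps_def indicator_def power2_norm_eq_inner)
qed

text \<open>In the coordinates \<open>z \<bullet> w\<close>, \<open>z \<bullet> z\<close> the
  intersection of the two annuli lies in a square of side \<open>4 * \<epsilon>\<close>. Its area
  cancels the two factors \<open>1 / (2 * \<epsilon>)\<close> and leaves 4, whatever \<epsilon> and
  the two centres are.\<close>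

lemma nn_integral_sigma_sigma_det2_le:
  "(\<integral>\<^sup>+x. \<sigma> (x - y1) * \<sigma> (x - y2) * ennreal \<bar>det2 (x - y1) (x - y2)\<bar> \<partial>lborel) \<le> 4"
proof -
  define w where "w = y2 - y1"
  define l h where "l = (1 - \<epsilon>)\<^sup>2" and "h = (1 + \<epsilon>)\<^sup>2"
  have hl: "h - l = 4 * \<epsilon>" by (simp add: h_def l_def power2_eq_square algebra_simps)
  \<comment> \<open>By polarization \<open>2 * (z \<bullet> w)\<close> equals
    \<open>z \<bullet> z + w \<bullet> w\<close> minus the squared norm of \<open>z - w\<close>, and
    both squared norms range over \<open>{l..h}\<close>.\<close>
  define p q where "p = (l + w \<bullet> w - h) / 2" and "q = (h + w \<bullet> w - l) / 2"
  have qp: "q - p = 4 * \<epsilon>" using hl by (simp add: p_def q_def field_simps)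
  have "(\<integral>\<^sup>+x. \<sigma> (x - y1) * \<sigma> (x - y2) * ennreal \<bar>det2 (x - y1) (x - y2)\<bar> \<partial>lborel)
      = (\<integral>\<^sup>+z. \<sigma> ((y1 + z) - y1) * \<sigma> ((y1 + z) - y2)
          * ennreal \<bar>det2 ((y1 + z) - y1) ((y1 + z) - y2)\<bar> \<partial>lborel)"
    by (rule nn_integral_lborel_plus[symmetric]) measurable
  also have "\<dots> \<le> (\<integral>\<^sup>+z. ennreal (1 / (2 * \<epsilon>) * (1 / (2 * \<epsilon>))) *
      (ennreal \<bar>det2 z w\<bar> * indicator {p..q} (z \<bullet> w) * indicator {l..h} (z \<bullet> z)) \<partial>lborel)"
  proof (rule nn_integral_mono)
    fix z :: "real^2"
    have e: "y1 + z - y1 = z" "y1 + z - y2 = z - w" by (simp_all add: w_def)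
    have d: "\<bar>det2 z (z - w)\<bar> = \<bar>det2 z w\<bar>" by (simp add: det2_def algebra_simps abs_minus_commute)
    have i: "(z - w) \<bullet> (z - w) = z \<bullet> z - 2 * (z \<bullet> w) + w \<bullet> w"
      by (simp add: inner_diff_left inner_diff_right inner_commute)
    show "\<sigma> ((y1 + z) - y1) * \<sigma> ((y1 + z) - y2) * ennreal \<bar>det2 ((y1 + z) - y1) ((y1 + z) - y2)\<bar>
        \<le> ennreal (1 / (2 * \<epsilon>) * (1 / (2 * \<epsilon>))) *
          (ennreal \<bar>det2 z w\<bar> * indicator {p..q} (z \<bullet> w) * indicator {l..h} (z \<bullet> z))"
    proof (cases "z \<bullet> z \<in> {l..h} \<and> (z - w) \<bullet> (z - w) \<in> {l..h}")
      case True
      then have "z \<bullet> w \<in> {p..q}" unfolding i p_def q_def by (auto simp: field_simps)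
      with True show ?thesis
        unfolding e d sigma_eq_indicator l_def[symmetric] h_def[symmetric]
        using eps_pos by (simp add: ennreal_mult[symmetric])
    next
      case False
      then show ?thesis
        unfolding e d sigma_eq_indicator l_def[symmetric] h_def[symmetric] by auto
    qed
  qed
  also have "\<dots> = ennreal (1 / (2 * \<epsilon>) * (1 / (2 * \<epsilon>))) *
      (\<integral>\<^sup>+z. ennreal \<bar>det2 z w\<bar> * indicator {p..q} (z \<bullet> w) * indicator {l..h} (z \<bullet> z) \<partial>lborel)"
    by (rule nn_integral_cmult) measurable
  also have "\<dots> \<le> ennreal (1 / (2 * \<epsilon>) * (1 / (2 * \<epsilon>))) * ennreal ((q - p) * (h - l))"
    by (intro mult_left_mono nn_integral_det2_strip_annulus_le) (use hl qp eps_pos in auto)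
  also have "\<dots> = 4"
    unfolding hl qp using eps_pos by (simp add: ennreal_mult[symmetric])
  finally show ?thesis .
qed

lemma nn_integral_sigma_le: "(\<integral>\<^sup>+z. \<sigma> z \<partial>lborel) \<le> 8"
proof -
  have em: "emeasure lborel {z::real^2. \<bar>norm z - 1\<bar> \<le> \<epsilon>} = ennreal (4 * pi * \<epsilon>)"
    using emeasure_annulus[of \<epsilon> 0] eps_pos eps_le by simp
  have "(\<integral>\<^sup>+z. \<sigma> z \<partial>lborel)
      = (\<integral>\<^sup>+z. ennreal (1 / (2 * \<epsilon>)) * indicator {z::real^2. \<bar>norm z - 1\<bar> \<le> \<epsilon>} z \<partial>lborel)"
    by (intro nn_integral_cong) (auto simp: sigma_eps_def)
  also have "\<dots> = ennreal (1 / (2 * \<epsilon>)) * ennreal (4 * pi * \<epsilon>)"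
    by (subst nn_integral_cmult_indicator) (auto simp: em)
  also have "\<dots> = ennreal (2 * pi)"
    using eps_pos by (simp add: ennreal_mult[symmetric])
  also have "\<dots> \<le> ennreal 8" using pi_less_4 by (intro ennreal_leI) simp
  finally show ?thesis by simp
qed

lemma nn_integral_sigma_shift_le: "(\<integral>\<^sup>+y. \<sigma> (y - x) \<partial>lborel) \<le> 8"
proof -
  have "(\<integral>\<^sup>+y. \<sigma> (y - x) \<partial>lborel) = (\<integral>\<^sup>+z. \<sigma> ((x + z) - x) \<partial>lborel)"
    by (rule nn_integral_lborel_plus[symmetric]) measurable
  then show ?thesis using nn_integral_sigma_le by simp
qed

text \<open>With \<open>w\<close> the quarter turn of \<open>u\<close>, the set is a strip in the
  direction of \<open>w\<close> and the Jacobian there is \<open>\<bar>z \<bullet> u\<bar>\<close>.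
  For \<open>d \<le> 1/4\<close> Lagrange's identity bounds it below by 1/4, so it can be inserted
  at the cost of a factor 4; for larger \<open>d\<close> the total mass 8 of the annulus
  suffices.\<close>

lemma nn_integral_sigma_strip_le:
  assumes u: "1/2 \<le> norm u" and d: "0 \<le> d"
  shows "(\<integral>\<^sup>+z. \<sigma> z * indicator {..d} \<bar>det2 u z\<bar> \<partial>lborel) \<le> ennreal (32 * d)"
proof (cases "d \<le> 1/4")
  case True
  define w where "w = (vector [- u$2, u$1] :: real^2)"
  have w: "z \<bullet> w = det2 u z" "\<bar>det2 z w\<bar> = \<bar>z \<bullet> u\<bar>" for z
    by (simp_all add: w_def det2_def inner_vec2)
  define l h where "l = (1 - \<epsilon>)\<^sup>2" and "h = (1 + \<epsilon>)\<^sup>2"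
  have hl: "h - l = 4 * \<epsilon>" by (simp add: h_def l_def power2_eq_square algebra_simps)
  have "(\<integral>\<^sup>+z. \<sigma> z * indicator {..d} \<bar>det2 u z\<bar> \<partial>lborel)
      \<le> (\<integral>\<^sup>+z. ennreal (4 / (2 * \<epsilon>)) *
      (ennreal \<bar>det2 z w\<bar> * indicator {-d..d} (z \<bullet> w) * indicator {l..h} (z \<bullet> z)) \<partial>lborel)"
  proof (rule nn_integral_mono)
    fix z
    show "\<sigma> z * indicator {..d} \<bar>det2 u z\<bar> \<le> ennreal (4 / (2 * \<epsilon>)) *
      (ennreal \<bar>det2 z w\<bar> * indicator {-d..d} (z \<bullet> w) * indicator {l..h} (z \<bullet> z))"
    proof (cases "z \<bullet> z \<in> {l..h} \<and> \<bar>det2 u z\<bar> \<le> d")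
      case T: True
      have "(19/20)\<^sup>2 \<le> l"
        unfolding l_def using eps_le by (intro power_mono) auto
      with T have "(19/20)\<^sup>2 \<le> z \<bullet> z" by auto
      moreover have "(1/2)\<^sup>2 \<le> u \<bullet> u" 
        using u unfolding power2_norm_eq_inner[symmetric] by (intro power_mono) auto
      ultimately have "(1/2)\<^sup>2 * (19/20)\<^sup>2 \<le> (u \<bullet> u) * (z \<bullet> z)" by (intro mult_mono) auto
      moreover have "\<bar>det2 u z\<bar>\<^sup>2 \<le> (1/4)\<^sup>2" using T True by (intro power_mono) auto
      ultimately have "(1/4)\<^sup>2 \<le> \<bar>z \<bullet> u\<bar>\<^sup>2"
        using lagrange_det2[of u z] by (simp add: power2_eq_square inner_commute)
      then have "1/4 \<le> \<bar>z \<bullet> u\<bar>" by (rule power2_le_imp_le) simp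
      then have "ennreal (1 / (2 * \<epsilon>)) \<le> ennreal (4 / (2 * \<epsilon>) * \<bar>det2 z w\<bar>)"
        unfolding w using eps_pos by (intro ennreal_leI) (simp add: field_simps)
      then show ?thesis
        using T eps_pos unfolding sigma_eq_indicator l_def[symmetric] h_def[symmetric] w
        by (auto simp: ennreal_mult[symmetric] abs_le_iff indicator_def)
    qed (auto simp: sigma_eq_indicator l_def h_def)
  qed
  also have "\<dots> = ennreal (4 / (2 * \<epsilon>)) *
      (\<integral>\<^sup>+z. ennreal \<bar>det2 z w\<bar> * indicator {-d..d} (z \<bullet> w) * indicator {l..h} (z \<bullet> z) \<partial>lborel)"
    by (rule nn_integral_cmult) measurable
  also have "\<dots> \<le> ennreal (4 / (2 * \<epsilon>)) * ennreal ((d - (-d)) * (h - l))"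
    by (intro mult_left_mono nn_integral_det2_strip_annulus_le) (use hl d eps_pos in auto)
  also have "\<dots> = ennreal (16 * d)"
    unfolding hl using eps_pos d by (simp add: ennreal_mult[symmetric])
  also have "\<dots> \<le> ennreal (32 * d)" using d by (intro ennreal_leI) simp
  finally show ?thesis .
next
  case False
  have "(\<integral>\<^sup>+z. \<sigma> z * indicator {..d} \<bar>det2 u z\<bar> \<partial>lborel) \<le> (\<integral>\<^sup>+z. \<sigma> z \<partial>lborel)"
    by (intro nn_integral_mono) (auto simp: indicator_def)
  also have "\<dots> \<le> ennreal 8" using nn_integral_sigma_le by simp
  also have "\<dots> \<le> ennreal (32 * d)" using False by (intro ennreal_leI) simp
  finally show ?thesis .
qed

text \<open>The three lengths confine \<open>a \<bullet> b\<close> to \<open>[0, 2/3]\<close>, and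
  in Lagrange's identity (19/20)^4 - (2/3)^2 exceeds 1/4.\<close>

lemma abs_det2_ge_half:
  assumes "\<sigma> a \<noteq> 0" "\<sigma> b \<noteq> 0" "\<sigma> (a - b) \<noteq> 0"
  shows "1/2 \<le> \<bar>det2 a b\<bar>"
proof -
  have sq: "(19/20)\<^sup>2 \<le> z \<bullet> z" "z \<bullet> z \<le> (21/20)\<^sup>2" if "\<sigma> z \<noteq> 0" for z
    using sigma_norm_bounds[OF that] unfolding power2_norm_eq_inner[symmetric]
    by (auto intro!: power_mono)
  note s = sq[OF assms(1)] sq[OF assms(2)] sq[OF assms(3)]
  have i: "(a - b) \<bullet> (a - b) = a \<bullet> a - 2 * (a \<bullet> b) + b \<bullet> b"
    by (simp add: inner_diff_left inner_diff_right inner_commute)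
  have "0 \<le> a \<bullet> b" "a \<bullet> b \<le> 2/3" using s unfolding i by (auto simp: power2_eq_square)
  then have "(a \<bullet> b)\<^sup>2 \<le> (2/3)\<^sup>2" by (intro power_mono) auto
  moreover have "(19/20)\<^sup>2 * (19/20)\<^sup>2 \<le> (a \<bullet> a) * (b \<bullet> b)" using s by (intro mult_mono) auto
  ultimately have "(1/2)\<^sup>2 \<le> \<bar>det2 a b\<bar>\<^sup>2" using lagrange_det2[of a b] by (simp add: power2_eq_square)
  then show ?thesis by (rule power2_le_imp_le) simp
qed

text \<open>When the third side is present the Jacobian is at least 1/2, so it can be inserted for a
  factor 2. This is how a vertex that carries no function, or a bounded one, is integrated out,
  leaving one annulus.\<close>

lemma nn_integral_triangle_le:
  "(\<integral>\<^sup>+y. \<sigma> (x - z) * \<sigma> (y - x) * \<sigma> (y - z) \<partial>lborel) \<le> 8 * \<sigma> (x - z)"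
proof -
  have "(\<integral>\<^sup>+y. \<sigma> (x - z) * \<sigma> (y - x) * \<sigma> (y - z) \<partial>lborel)
      \<le> (\<integral>\<^sup>+y. (2 * \<sigma> (x - z)) * (\<sigma> (y - x) * \<sigma> (y - z) * ennreal \<bar>det2 (y - x) (y - z)\<bar>) \<partial>lborel)"
  proof (rule nn_integral_mono)
    fix y
    show "\<sigma> (x - z) * \<sigma> (y - x) * \<sigma> (y - z)
      \<le> (2 * \<sigma> (x - z)) * (\<sigma> (y - x) * \<sigma> (y - z) * ennreal \<bar>det2 (y - x) (y - z)\<bar>)"
    proof (cases "\<sigma> (x - z) \<noteq> 0 \<and> \<sigma> (y - x) \<noteq> 0 \<and> \<sigma> (y - z) \<noteq> 0")
      case True
      have "1/2 \<le> \<bar>det2 (y - x) (y - z)\<bar>"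
        using True by (intro abs_det2_ge_half) (auto simp: sigma_eps_minus_commute)
      then have "1 \<le> ennreal (2 * \<bar>det2 (y - x) (y - z)\<bar>)" by (simp add: ennreal_ge_1)
      then have "\<sigma> (x - z) * \<sigma> (y - x) * \<sigma> (y - z) * 1
        \<le> \<sigma> (x - z) * \<sigma> (y - x) * \<sigma> (y - z) * ennreal (2 * \<bar>det2 (y - x) (y - z)\<bar>)"
        by (rule mult_left_mono) simp
      then show ?thesis by (simp add: ennreal_mult mult_ac)
    qed auto
  qed
  also have "\<dots> = (2 * \<sigma> (x - z)) *
      (\<integral>\<^sup>+y. \<sigma> (y - x) * \<sigma> (y - z) * ennreal \<bar>det2 (y - x) (y - z)\<bar> \<partial>lborel)"
    by (rule nn_integral_cmult) measurable
  also have "\<dots> \<le> (2 * \<sigma> (x - z)) * 4"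
    using nn_integral_sigma_sigma_det2_le by (rule mult_left_mono) simp
  also have "\<dots> = 8 * \<sigma> (x - z)" by (simp add: mult.commute mult.left_commute mult.assoc[symmetric])
  finally show ?thesis .
qed

end

section \<open>The vertices (1,0,0) and (1/2,1/2,1/2)\<close>

lemma ennreal_mult_le_squares: "(a::ennreal) * b \<le> a * a + b * b"
proof (cases "a \<le> b")
  case True
  then have "a * b \<le> b * b" by (rule mult_right_mono) simp
  then show ?thesis by (rule order_trans) simp
next
  case False
  then have "a * b \<le> a * a" by (intro mult_left_mono) auto
  then show ?thesis by (rule order_trans) simp
qed

lemma nn_integral_iterated_mult:
  assumes [measurable]: "(\<lambda>(x, y). g x y) \<in> borel_measurable (lborel \<Otimes>\<^sub>M lborel)"
    and [measurable]: "(\<lambda>(x, y). h x y) \<in> borel_measurable (lborel \<Otimes>\<^sub>M lborel)"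
  shows "(\<integral>\<^sup>+x. \<integral>\<^sup>+y. g x y \<partial>lborel \<partial>lborel) * (\<integral>\<^sup>+x. \<integral>\<^sup>+y. h x y \<partial>lborel \<partial>lborel)
    = (\<integral>\<^sup>+x. \<integral>\<^sup>+y. \<integral>\<^sup>+u. \<integral>\<^sup>+v. g x y * h u v \<partial>lborel \<partial>lborel \<partial>lborel \<partial>lborel)"
  by (simp add: nn_integral_cmult nn_integral_multc)

context thin_annulus
begin

definition Lam :: "(real^2 \<Rightarrow> ennreal) \<Rightarrow> (real^2 \<Rightarrow> ennreal) \<Rightarrow> (real^2 \<Rightarrow> ennreal) \<Rightarrow> ennreal" where
  "Lam F G H = (\<integral>\<^sup>+x. \<integral>\<^sup>+y. \<integral>\<^sup>+z. \<sigma> (x - y) * \<sigma> (x - z) * \<sigma> (y - z) * F x * G y * H z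
      \<partial>lborel \<partial>lborel \<partial>lborel)"

lemma Lambda_eps_eq_Lam:
  "Lambda_eps \<epsilon> f1 f2 f3 = Lam (\<lambda>x. ennreal (f1 x)) (\<lambda>x. ennreal (f2 x)) (\<lambda>x. ennreal (f3 x))"
  by (simp add: Lambda_eps_def Lam_def nn_integral_completion)

lemma Lam_swap23:
  assumes [measurable]: "F \<in> borel_measurable borel" "G \<in> borel_measurable borel" "H \<in> borel_measurable borel"
  shows "Lam F G H = Lam F H G"
  unfolding Lam_def
proof (rule nn_integral_cong)
  fix x
  show "(\<integral>\<^sup>+y. \<integral>\<^sup>+z. \<sigma> (x - y) * \<sigma> (x - z) * \<sigma> (y - z) * F x * G y * H z \<partial>lborel \<partial>lborel)
    = (\<integral>\<^sup>+y. \<integral>\<^sup>+z. \<sigma> (x - y) * \<sigma> (x - z) * \<sigma> (y - z) * F x * H y * G z \<partial>lborel \<partial>lborel)"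
    by (subst lborel_pair.Fubini', measurable, intro nn_integral_cong)
       (simp add: mult_ac sigma_eps_minus_commute)
qed

lemma Lam_swap12:
  assumes [measurable]: "F \<in> borel_measurable borel" "G \<in> borel_measurable borel" "H \<in> borel_measurable borel"
  shows "Lam F G H = Lam G F H"
  unfolding Lam_def
  by (subst lborel_pair.Fubini', measurable, intro nn_integral_cong)
     (simp add: mult_ac sigma_eps_minus_commute)

text \<open>The triangle kernel as seen from \<open>z\<close>: this is the vertex that two triangles
  will share, and all determinants are formed from vectors issuing from it.\<close>

definition K :: "real^2 \<Rightarrow> real^2 \<Rightarrow> real^2 \<Rightarrow> ennreal" where
  "K z x y = \<sigma> (x - z) * \<sigma> (y - x) * \<sigma> (y - z)"

lemma K_commute: "K z x y = K z y x"
  by (simp add: K_def mult_ac sigma_eps_minus_commute)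

lemma borel_measurable_K [measurable (raw)]:
  assumes [measurable]: "f \<in> borel_measurable M" "g \<in> borel_measurable M" "h \<in> borel_measurable M"
  shows "(\<lambda>x. K (f x) (g x) (h x)) \<in> borel_measurable M"
  unfolding K_def by measurable

lemma Lam_eq_K:
  assumes [measurable]: "F \<in> borel_measurable borel" "G \<in> borel_measurable borel" "H \<in> borel_measurable borel"
  shows "Lam F G H = (\<integral>\<^sup>+z. H z * (\<integral>\<^sup>+x. \<integral>\<^sup>+y. K z x y * F x * G y \<partial>lborel \<partial>lborel) \<partial>lborel)"
proof -
  have "Lam F G H = Lam H F G"
    by (subst Lam_swap23) (simp_all add: Lam_swap12)
  also have "\<dots> = (\<integral>\<^sup>+z. \<integral>\<^sup>+x. \<integral>\<^sup>+y. H z * (K z x y * F x * G y) \<partial>lborel \<partial>lborel \<partial>lborel)"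
    unfolding Lam_def K_def by (intro nn_integral_cong) (simp add: mult_ac sigma_eps_minus_commute)
  also have "\<dots> = (\<integral>\<^sup>+z. H z * (\<integral>\<^sup>+x. \<integral>\<^sup>+y. K z x y * F x * G y \<partial>lborel \<partial>lborel) \<partial>lborel)"
    by (simp add: nn_integral_cmult)
  finally show ?thesis .
qed

lemma nn_integral_K_fst_le:
  assumes [measurable]: "\<phi> \<in> borel_measurable borel"
  shows "(\<integral>\<^sup>+x. \<integral>\<^sup>+y. K z x y * \<phi> x \<partial>lborel \<partial>lborel) \<le> 8 * (\<integral>\<^sup>+x. \<sigma> (x - z) * \<phi> x \<partial>lborel)"
proof -
  have "(\<integral>\<^sup>+x. \<integral>\<^sup>+y. K z x y * \<phi> x \<partial>lborel \<partial>lborel) = (\<integral>\<^sup>+x. (\<integral>\<^sup>+y. K z x y \<partial>lborel) * \<phi> x \<partial>lborel)"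
    by (simp add: nn_integral_multc)
  also have "\<dots> \<le> (\<integral>\<^sup>+x. (8 * \<sigma> (x - z)) * \<phi> x \<partial>lborel)"
    unfolding K_def by (intro nn_integral_mono mult_right_mono nn_integral_triangle_le) simp
  also have "\<dots> = 8 * (\<integral>\<^sup>+x. \<sigma> (x - z) * \<phi> x \<partial>lborel)"
    by (simp add: nn_integral_cmult mult.assoc)
  finally show ?thesis .
qed

lemma nn_integral_K_snd_le:
  assumes [measurable]: "\<phi> \<in> borel_measurable borel"
  shows "(\<integral>\<^sup>+x. \<integral>\<^sup>+y. K z x y * \<phi> y \<partial>lborel \<partial>lborel) \<le> 8 * (\<integral>\<^sup>+x. \<sigma> (x - z) * \<phi> x \<partial>lborel)"
proof -
  have "(\<integral>\<^sup>+x. \<integral>\<^sup>+y. K z x y * \<phi> y \<partial>lborel \<partial>lborel) = (\<integral>\<^sup>+y. \<integral>\<^sup>+x. K z y x * \<phi> y \<partial>lborel \<partial>lborel)"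
    by (subst lborel_pair.Fubini', measurable) (simp add: K_commute)
  also have "\<dots> \<le> 8 * (\<integral>\<^sup>+x. \<sigma> (x - z) * \<phi> x \<partial>lborel)"
    by (rule nn_integral_K_fst_le) measurable
  finally show ?thesis .
qed

text \<open>Tonelli makes \<open>z\<close> the innermost variable. Its integral is at most 4
  uniformly in \<open>p\<close> and \<open>q\<close>, which decouples \<phi> from \<psi>; reversing
  both vectors does not change the determinant.\<close>

lemma nn_integral_bilinear_det2_le:
  assumes [measurable]: "\<phi> \<in> borel_measurable borel" "\<psi> \<in> borel_measurable borel"
  shows "(\<integral>\<^sup>+z. \<integral>\<^sup>+p. \<sigma> (p - z) * (\<phi> p * (\<integral>\<^sup>+q. \<sigma> (q - z) * (\<psi> q * ennreal \<bar>det2 (p - z) (q - z)\<bar>)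
      \<partial>lborel)) \<partial>lborel \<partial>lborel)
    \<le> 4 * (\<integral>\<^sup>+p. \<phi> p \<partial>lborel) * (\<integral>\<^sup>+q. \<psi> q \<partial>lborel)"
proof -
  define X where "X z p q = \<sigma> (z - p) * \<sigma> (z - q) * ennreal \<bar>det2 (z - p) (z - q)\<bar>" for z p q
  have X: "\<sigma> (p - z) * (\<phi> p * (\<sigma> (q - z) * (\<psi> q * ennreal \<bar>det2 (p - z) (q - z)\<bar>)))
      = X z p q * (\<phi> p * \<psi> q)" for z p q
    using det2_minus(1)[of "z - p" "q - z"] det2_minus(2)[of "z - p" "z - q"]
    by (simp add: X_def mult_ac sigma_eps_minus_commute)
  have [measurable]: "(\<lambda>x. X (f x) (g x) (h x)) \<in> borel_measurable M"
    if [measurable]: "f \<in> borel_measurable M" "g \<in> borel_measurable M" "h \<in> borel_measurable M"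
    for f g h and M :: "'b measure"
    unfolding X_def by measurable
  have "(\<integral>\<^sup>+z. \<integral>\<^sup>+p. \<sigma> (p - z) * (\<phi> p * (\<integral>\<^sup>+q. \<sigma> (q - z) * (\<psi> q * ennreal \<bar>det2 (p - z) (q - z)\<bar>)
      \<partial>lborel)) \<partial>lborel \<partial>lborel) = (\<integral>\<^sup>+z. \<integral>\<^sup>+p. \<integral>\<^sup>+q. X z p q * (\<phi> p * \<psi> q) \<partial>lborel \<partial>lborel \<partial>lborel)"
    unfolding X[symmetric] by (simp add: nn_integral_cmult)
  also have "\<dots> = (\<integral>\<^sup>+p. \<integral>\<^sup>+z. \<integral>\<^sup>+q. X z p q * (\<phi> p * \<psi> q) \<partial>lborel \<partial>lborel \<partial>lborel)"
    by (rule lborel_pair.Fubini') measurable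
  also have "\<dots> = (\<integral>\<^sup>+p. \<integral>\<^sup>+q. \<integral>\<^sup>+z. X z p q * (\<phi> p * \<psi> q) \<partial>lborel \<partial>lborel \<partial>lborel)"
    by (intro nn_integral_cong lborel_pair.Fubini') measurable
  also have "\<dots> = (\<integral>\<^sup>+p. \<integral>\<^sup>+q. (\<integral>\<^sup>+z. X z p q \<partial>lborel) * (\<phi> p * \<psi> q) \<partial>lborel \<partial>lborel)"
    by (simp add: nn_integral_multc)
  also have "\<dots> \<le> (\<integral>\<^sup>+p. \<integral>\<^sup>+q. 4 * (\<phi> p * \<psi> q) \<partial>lborel \<partial>lborel)"
    unfolding X_def by (intro nn_integral_mono mult_right_mono nn_integral_sigma_sigma_det2_le) simp
  also have "\<dots> = 4 * (\<integral>\<^sup>+p. \<phi> p \<partial>lborel) * (\<integral>\<^sup>+q. \<psi> q \<partial>lborel)"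
    by (simp add: nn_integral_cmult nn_integral_multc mult.assoc)
  finally show ?thesis .
qed

text \<open>The Pluecker relation \<open>det2 a b * det2 a' b' = det2 a a' * det2 b b' - det2 a b' * det2 b a'\<close>
  trades the nondegeneracy of the two triangles for the Jacobians of the pairs that are integrated.\<close>
lemma K_mult_K_le:
  "(K z x y * F x * G y) * (K z u v * F u * G v)
    \<le> 8 * (K z x y * (F x * F x * (K z u v * (F u * F u * ennreal \<bar>det2 (x - z) (u - z)\<bar>)))
         + K z x y * (G y * G y * (K z u v * (G v * G v * ennreal \<bar>det2 (y - z) (v - z)\<bar>)))
         + K z x y * (F x * F x * (K z u v * (G v * G v * ennreal \<bar>det2 (x - z) (v - z)\<bar>)))
         + K z x y * (G y * G y * (K z u v * (F u * F u * ennreal \<bar>det2 (y - z) (u - z)\<bar>))))"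
proof (cases "K z x y = 0 \<or> K z u v = 0")
  case False
  then have s: "\<sigma> (x - z) \<noteq> 0" "\<sigma> (y - z) \<noteq> 0" "\<sigma> (y - x) \<noteq> 0" "\<sigma> (u - z) \<noteq> 0" "\<sigma> (v - z) \<noteq> 0" "\<sigma> (v - u) \<noteq> 0"
    by (auto simp: K_def)
  define d where "d p q = \<bar>det2 (p - z) (q - z)\<bar>" for p q
  have d2: "d p q \<le> 2" if "\<sigma> (p - z) \<noteq> 0" "\<sigma> (q - z) \<noteq> 0" for p q
  proof -
    have "d p q \<le> norm (p - z) * norm (q - z)" unfolding d_def by (rule abs_det2_le)
    also have "\<dots> \<le> 21/20 * (21/20)"
      using sigma_norm_bounds[OF that(1)] sigma_norm_bounds[OF that(2)] by (intro mult_mono) auto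
    finally show ?thesis by simp
  qed
  \<comment> \<open>Each triangle is nondegenerate, so the product of their own determinants is at
    least 1/4; by the Pluecker relation the two mixed products cannot both be small.\<close>
  have "1/2 \<le> d x y" unfolding d_def using s by (intro abs_det2_ge_half) (auto simp: sigma_eps_minus_commute)
  moreover have "1/2 \<le> d u v" unfolding d_def using s by (intro abs_det2_ge_half) (auto simp: sigma_eps_minus_commute)
  ultimately have "1/2 * (1/2) \<le> d x y * d u v" by (intro mult_mono) (auto simp: d_def)
  also have "d x y * d u v = \<bar>det2 (x - z) (u - z) * det2 (y - z) (v - z)
      - det2 (x - z) (v - z) * det2 (y - z) (u - z)\<bar>"
    unfolding d_def abs_mult[symmetric] by (rule arg_cong[where f = abs]) (simp add: det2_def algebra_simps)
  also have "\<dots> \<le> d x u * d y v + d x v * d y u"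
    unfolding d_def abs_mult[symmetric] by (rule abs_triangle_ineq4)
  finally have "1 \<le> ennreal (4 * (d x u * d y v + d x v * d y u))" by (simp add: ennreal_ge_1)
  also have "\<dots> = 4 * (ennreal (d x u) * ennreal (d y v) + ennreal (d x v) * ennreal (d y u))"
    by (simp add: ennreal_mult d_def)
  finally have one: "1 \<le> 4 * (ennreal (d x u) * ennreal (d y v) + ennreal (d x v) * ennreal (d y u))" .
  \<comment> \<open>Of the two determinants in a mixed product each square keeps one and bounds the
    other by 2. The kept one belongs to the two points on which the square depends, so the remaining
    two vertices are free to be integrated out.\<close>
  have amgm: "A * B * (c1 * c2) \<le> 2 * (A * A * c1 + B * B * c2)" if "c1 \<le> 2" "c2 \<le> 2" for A B c1 c2 :: ennreal
  proof -
    have "A * B * (c1 * c2) \<le> (A * A + B * B) * (c1 * c2)"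
      by (intro mult_right_mono ennreal_mult_le_squares) simp
    also have "\<dots> = A * A * c1 * c2 + B * B * c2 * c1" by (simp add: algebra_simps)
    also have "\<dots> \<le> A * A * c1 * 2 + B * B * c2 * 2"
      using that by (intro add_mono mult_left_mono) auto
    finally show ?thesis by (simp add: algebra_simps)
  qed
  have le2: "ennreal (d p q) \<le> 2" if "\<sigma> (p - z) \<noteq> 0" "\<sigma> (q - z) \<noteq> 0" for p q
    using d2[OF that] by (metis ennreal_leI ennreal_numeral zero_le_numeral)
  have "F x * G y * F u * G v * 1
      \<le> F x * G y * F u * G v * (4 * (ennreal (d x u) * ennreal (d y v) + ennreal (d x v) * ennreal (d y u)))"
    using one by (rule mult_left_mono) simp
  also have "\<dots> = 4 * ((F x * F u) * (G y * G v) * (ennreal (d x u) * ennreal (d y v))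
      + (F x * G v) * (G y * F u) * (ennreal (d x v) * ennreal (d y u)))"
    by (simp add: algebra_simps)
  also have "\<dots> \<le> 4 * (2 * ((F x * F u) * (F x * F u) * ennreal (d x u) + (G y * G v) * (G y * G v) * ennreal (d y v))
      + 2 * ((F x * G v) * (F x * G v) * ennreal (d x v) + (G y * F u) * (G y * F u) * ennreal (d y u)))"
    using s by (intro mult_left_mono add_mono amgm le2) auto
  finally have "K z x y * K z u v * (F x * G y * F u * G v) \<le> K z x y * K z u v *
     (4 * (2 * ((F x * F u) * (F x * F u) * ennreal (d x u) + (G y * G v) * (G y * G v) * ennreal (d y v))
      + 2 * ((F x * G v) * (F x * G v) * ennreal (d x v) + (G y * F u) * (G y * F u) * ennreal (d y u))))"
    by (intro mult_left_mono) auto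
  then show ?thesis unfolding d_def by (simp add: algebra_simps)
qed auto

text \<open>The square of the bilinear operator is an integral over pairs of triangles with common
  vertex \<open>z\<close>. The pointwise kernel inequality gives four terms with prefactor 8; each
  costs 8 for either free vertex and 4 for the bilinear form, hence
  \<open>8192 = 8 * 4 * (8 * 8 * 4)\<close>.\<close>

lemma nn_integral_K_square_le:
  assumes [measurable]: "F \<in> borel_measurable borel" "G \<in> borel_measurable borel"
    and F: "(\<integral>\<^sup>+x. F x * F x \<partial>lborel) \<le> 1" and G: "(\<integral>\<^sup>+x. G x * G x \<partial>lborel) \<le> 1"
  defines "B \<equiv> \<lambda>z. \<integral>\<^sup>+x. \<integral>\<^sup>+y. K z x y * F x * G y \<partial>lborel \<partial>lborel"
  shows "(\<integral>\<^sup>+z. B z * B z \<partial>lborel) \<le> 8192"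
proof -
  define d where "d z p q = ennreal \<bar>det2 (p - z) (q - z)\<bar>" for z p q
  have [measurable]: "(\<lambda>x. d (f x) (g x) (h x)) \<in> borel_measurable M"
    if [measurable]: "f \<in> borel_measurable M" "g \<in> borel_measurable M" "h \<in> borel_measurable M"
    for f g h and M :: "'b measure"
    unfolding d_def by measurable
  define J where "J \<phi> \<psi> z = (\<integral>\<^sup>+p. \<sigma> (p - z) * (\<phi> p * (\<integral>\<^sup>+q. \<sigma> (q - z) * (\<psi> q * d z p q) \<partial>lborel)) \<partial>lborel)"
    for \<phi> \<psi> :: "real^2 \<Rightarrow> ennreal" and z
  let ?F = "\<lambda>x. F x * F x" and ?G = "\<lambda>x. G x * G x"
  have [measurable]: "(\<lambda>x. J \<phi> \<psi> (f x)) \<in> borel_measurable M"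
    if [measurable]: "\<phi> \<in> borel_measurable borel" "\<psi> \<in> borel_measurable borel" "f \<in> borel_measurable M" 
    for f \<phi> \<psi> and M :: "'b measure"
    unfolding J_def by measurable
  have J: "(\<integral>\<^sup>+z. J \<phi> \<psi> z \<partial>lborel) \<le> 4"
    if [measurable]: "\<phi> \<in> borel_measurable borel" "\<psi> \<in> borel_measurable borel"
      and "(\<integral>\<^sup>+x. \<phi> x \<partial>lborel) \<le> 1" "(\<integral>\<^sup>+x. \<psi> x \<partial>lborel) \<le> 1" for \<phi> \<psi>
  proof -
    have "(\<integral>\<^sup>+z. J \<phi> \<psi> z \<partial>lborel) \<le> 4 * (\<integral>\<^sup>+p. \<phi> p \<partial>lborel) * (\<integral>\<^sup>+q. \<psi> q \<partial>lborel)"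
      unfolding J_def d_def by (rule nn_integral_bilinear_det2_le) measurable
    also have "\<dots> \<le> 4 * 1 * 1" using that by (intro mult_mono) auto
    finally show ?thesis by simp
  qed
  \<comment> \<open>The four terms correspond to the choice of one weighted vertex in each triangle:
    \<open>x\<close> or \<open>y\<close> in the one, \<open>u\<close> or \<open>v\<close> in the
    other. The opposite vertex carries no function and disappears by the triangle estimate.\<close>
  define T1 where "T1 z = (\<integral>\<^sup>+x. \<integral>\<^sup>+y. \<integral>\<^sup>+u. \<integral>\<^sup>+v. K z x y * (?F x * (K z u v * (?F u * d z x u)))
      \<partial>lborel \<partial>lborel \<partial>lborel \<partial>lborel)" for z
  define T2 where "T2 z = (\<integral>\<^sup>+x. \<integral>\<^sup>+y. \<integral>\<^sup>+u. \<integral>\<^sup>+v. K z x y * (?G y * (K z u v * (?G v * d z y v)))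
      \<partial>lborel \<partial>lborel \<partial>lborel \<partial>lborel)" for z
  define T3 where "T3 z = (\<integral>\<^sup>+x. \<integral>\<^sup>+y. \<integral>\<^sup>+u. \<integral>\<^sup>+v. K z x y * (?F x * (K z u v * (?G v * d z x v)))
      \<partial>lborel \<partial>lborel \<partial>lborel \<partial>lborel)" for z
  define T4 where "T4 z = (\<integral>\<^sup>+x. \<integral>\<^sup>+y. \<integral>\<^sup>+u. \<integral>\<^sup>+v. K z x y * (?G y * (K z u v * (?F u * d z y u)))
      \<partial>lborel \<partial>lborel \<partial>lborel \<partial>lborel)" for z
  have fin: "(\<integral>\<^sup>+p. \<sigma> (p - z) * (\<phi> p * (8 * (\<integral>\<^sup>+q. \<sigma> (q - z) * (\<psi> q * d z p q) \<partial>lborel))) \<partial>lborel) = 8 * J \<phi> \<psi> z"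
    if [measurable]: "\<phi> \<in> borel_measurable borel" "\<psi> \<in> borel_measurable borel" for \<phi> \<psi> z
    unfolding J_def by (subst nn_integral_cmult[symmetric], measurable) (simp add: mult_ac)
  have "T1 z \<le> (\<integral>\<^sup>+x. \<integral>\<^sup>+y. K z x y * (?F x * (8 * (\<integral>\<^sup>+u. \<sigma> (u - z) * (?F u * d z x u) \<partial>lborel))) \<partial>lborel \<partial>lborel)" for z
    unfolding T1_def by (simp add: nn_integral_cmult) (intro nn_integral_mono mult_left_mono nn_integral_K_fst_le; simp)
  also have "\<dots> z \<le> 8 * (\<integral>\<^sup>+x. \<sigma> (x - z) * (?F x * (8 * (\<integral>\<^sup>+u. \<sigma> (u - z) * (?F u * d z x u) \<partial>lborel))) \<partial>lborel)" for z
    by (rule nn_integral_K_fst_le) measurable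
  finally have T1: "T1 z \<le> 8 * (8 * J ?F ?F z)" for z by (simp add: fin[of ?F ?F])
  have "T2 z \<le> (\<integral>\<^sup>+x. \<integral>\<^sup>+y. K z x y * (?G y * (8 * (\<integral>\<^sup>+u. \<sigma> (u - z) * (?G u * d z y u) \<partial>lborel))) \<partial>lborel \<partial>lborel)" for z
    unfolding T2_def by (simp add: nn_integral_cmult) (intro nn_integral_mono mult_left_mono nn_integral_K_snd_le; simp)
  also have "\<dots> z \<le> 8 * (\<integral>\<^sup>+x. \<sigma> (x - z) * (?G x * (8 * (\<integral>\<^sup>+u. \<sigma> (u - z) * (?G u * d z x u) \<partial>lborel))) \<partial>lborel)" for z
    by (rule nn_integral_K_snd_le) measurable
  finally have T2: "T2 z \<le> 8 * (8 * J ?G ?G z)" for z by (simp add: fin[of ?G ?G])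
  have "T3 z \<le> (\<integral>\<^sup>+x. \<integral>\<^sup>+y. K z x y * (?F x * (8 * (\<integral>\<^sup>+u. \<sigma> (u - z) * (?G u * d z x u) \<partial>lborel))) \<partial>lborel \<partial>lborel)" for z
    unfolding T3_def by (simp add: nn_integral_cmult) (intro nn_integral_mono mult_left_mono nn_integral_K_snd_le; simp)
  also have "\<dots> z \<le> 8 * (\<integral>\<^sup>+x. \<sigma> (x - z) * (?F x * (8 * (\<integral>\<^sup>+u. \<sigma> (u - z) * (?G u * d z x u) \<partial>lborel))) \<partial>lborel)" for z
    by (rule nn_integral_K_fst_le) measurable
  finally have T3: "T3 z \<le> 8 * (8 * J ?F ?G z)" for z by (simp add: fin[of ?F ?G])
  have "T4 z \<le> (\<integral>\<^sup>+x. \<integral>\<^sup>+y. K z x y * (?G y * (8 * (\<integral>\<^sup>+u. \<sigma> (u - z) * (?F u * d z y u) \<partial>lborel))) \<partial>lborel \<partial>lborel)" for z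
    unfolding T4_def by (simp add: nn_integral_cmult) (intro nn_integral_mono mult_left_mono nn_integral_K_fst_le; simp)
  also have "\<dots> z \<le> 8 * (\<integral>\<^sup>+x. \<sigma> (x - z) * (?G x * (8 * (\<integral>\<^sup>+u. \<sigma> (u - z) * (?F u * d z x u) \<partial>lborel))) \<partial>lborel)" for z
    by (rule nn_integral_K_snd_le) measurable
  finally have T4: "T4 z \<le> 8 * (8 * J ?G ?F z)" for z by (simp add: fin[of ?G ?F])
  have "B z * B z \<le> 8 * (T1 z + T2 z + T3 z + T4 z)" for z
  proof -
    have "B z * B z = (\<integral>\<^sup>+x. \<integral>\<^sup>+y. \<integral>\<^sup>+u. \<integral>\<^sup>+v. (K z x y * F x * G y) * (K z u v * F u * G v)
      \<partial>lborel \<partial>lborel \<partial>lborel \<partial>lborel)"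
      unfolding B_def by (rule nn_integral_iterated_mult) measurable
    also have "\<dots> \<le> (\<integral>\<^sup>+x. \<integral>\<^sup>+y. \<integral>\<^sup>+u. \<integral>\<^sup>+v. 8 * (K z x y * (?F x * (K z u v * (?F u * d z x u)))
         + K z x y * (?G y * (K z u v * (?G v * d z y v)))
         + K z x y * (?F x * (K z u v * (?G v * d z x v)))
         + K z x y * (?G y * (K z u v * (?F u * d z y u)))) \<partial>lborel \<partial>lborel \<partial>lborel \<partial>lborel)"
      unfolding d_def by (intro nn_integral_mono K_mult_K_le)
    also have "\<dots> = 8 * (T1 z + T2 z + T3 z + T4 z)"
      unfolding T1_def T2_def T3_def T4_def
      by (simp add: nn_integral_add nn_integral_cmult del: distrib_left_numeral)
    finally show ?thesis .
  qed
  also have "8 * (T1 z + T2 z + T3 z + T4 z) \<le> 8 * (8 * (8 * J ?F ?F z) + 8 * (8 * J ?G ?G z) + 8 * (8 * J ?F ?G z) + 8 * (8 * J ?G ?F z))" for z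
    by (intro mult_left_mono add_mono T1 T2 T3 T4) simp
  finally have "(\<integral>\<^sup>+z. B z * B z \<partial>lborel)
      \<le> (\<integral>\<^sup>+z. 8 * (8 * (8 * J ?F ?F z) + 8 * (8 * J ?G ?G z) + 8 * (8 * J ?F ?G z) + 8 * (8 * J ?G ?F z)) \<partial>lborel)"
    by (rule nn_integral_mono)
  also have "\<dots> = 8 * (64 * (\<integral>\<^sup>+z. J ?F ?F z \<partial>lborel) + 64 * (\<integral>\<^sup>+z. J ?G ?G z \<partial>lborel)
      + 64 * (\<integral>\<^sup>+z. J ?F ?G z \<partial>lborel) + 64 * (\<integral>\<^sup>+z. J ?G ?F z \<partial>lborel))"
    by (simp add: nn_integral_add nn_integral_cmult)
  also have "\<dots> \<le> 8 * (8 * (8 * 4) + 8 * (8 * 4) + 8 * (8 * 4) + 8 * (8 * 4))"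
    using J[of ?F ?F, THEN mult_left_mono[of _ _ 64]] J[of ?G ?G, THEN mult_left_mono[of _ _ 64]]
      J[of ?F ?G, THEN mult_left_mono[of _ _ 64]] J[of ?G ?F, THEN mult_left_mono[of _ _ 64]] F G
    by (intro mult_left_mono add_mono) simp_all
  finally show ?thesis by simp
qed

text \<open>For functions of norm at most 1 Cauchy-Schwarz may be replaced by the pointwise bound of
  \<open>H z * B z\<close> by the sum of the squares, which gives 1 + 8192.\<close>

lemma Lam_half_half_half_le:
  assumes [measurable]: "F \<in> borel_measurable borel" "G \<in> borel_measurable borel" "H \<in> borel_measurable borel"
    and F: "(\<integral>\<^sup>+x. F x * F x \<partial>lborel) \<le> 1" and G: "(\<integral>\<^sup>+x. G x * G x \<partial>lborel) \<le> 1"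
    and H: "(\<integral>\<^sup>+x. H x * H x \<partial>lborel) \<le> 1"
  shows "Lam F G H \<le> 8193"
proof -
  define B where "B z = (\<integral>\<^sup>+x. \<integral>\<^sup>+y. K z x y * F x * G y \<partial>lborel \<partial>lborel)" for z
  have [measurable]: "B \<in> borel_measurable borel" unfolding B_def by measurable
  have "Lam F G H \<le> (\<integral>\<^sup>+z. H z * H z + B z * B z \<partial>lborel)"
    unfolding Lam_eq_K[OF assms(1-3)] B_def[symmetric] by (intro nn_integral_mono ennreal_mult_le_squares)
  also have "\<dots> = (\<integral>\<^sup>+z. H z * H z \<partial>lborel) + (\<integral>\<^sup>+z. B z * B z \<partial>lborel)"
    by (rule nn_integral_add) measurable
  also have "\<dots> \<le> 1 + 8192"
    using nn_integral_K_square_le[OF assms(1,2) F G] H unfolding B_def by (intro add_mono)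
  finally show ?thesis by simp
qed

text \<open>Seen from the vertex carrying \<open>F\<close>, the kernel has total mass at most
  \<open>8 * 8\<close>: one factor for closing the triangle, one for the annulus.\<close>

lemma Lam_one_zero_zero_le:
  assumes [measurable]: "F \<in> borel_measurable borel" "G \<in> borel_measurable borel" "H \<in> borel_measurable borel"
    and F: "(\<integral>\<^sup>+x. F x \<partial>lborel) \<le> 1" and G: "\<And>x. G x \<le> 1" and H: "\<And>x. H x \<le> 1"
  shows "Lam F G H \<le> 64"
proof -
  have "Lam F G H = Lam H G F"
    by (subst Lam_swap12, measurable, subst Lam_swap23, measurable, subst Lam_swap12, measurable)
  also have "\<dots> \<le> (\<integral>\<^sup>+z. F z * (8 * (\<integral>\<^sup>+x. \<sigma> (x - z) * 1 \<partial>lborel)) \<partial>lborel)"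
    unfolding Lam_eq_K[OF assms(3,2,1)]
  proof (intro nn_integral_mono mult_left_mono)
    fix z
    have "(\<integral>\<^sup>+x. \<integral>\<^sup>+y. K z x y * H x * G y \<partial>lborel \<partial>lborel) \<le> (\<integral>\<^sup>+x. \<integral>\<^sup>+y. K z x y * 1 * 1 \<partial>lborel \<partial>lborel)"
      by (intro nn_integral_mono mult_mono G H) auto
    also have "\<dots> \<le> 8 * (\<integral>\<^sup>+x. \<sigma> (x - z) * 1 \<partial>lborel)"
      using nn_integral_K_fst_le[of "\<lambda>x. 1" z] by simp
    finally show "(\<integral>\<^sup>+x. \<integral>\<^sup>+y. K z x y * H x * G y \<partial>lborel \<partial>lborel) \<le> 8 * (\<integral>\<^sup>+x. \<sigma> (x - z) * 1 \<partial>lborel)" .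
  qed simp
  also have "\<dots> \<le> (\<integral>\<^sup>+z. F z * (8 * 8) \<partial>lborel)"
    using nn_integral_sigma_shift_le by (intro nn_integral_mono mult_left_mono) auto
  also have "\<dots> = (\<integral>\<^sup>+z. F z \<partial>lborel) * (8 * 8)" by (rule nn_integral_multc) measurable
  also have "\<dots> \<le> 1 * (8 * 8)" using F by (intro mult_right_mono) auto
  finally show ?thesis by simp
qed

end

section \<open>The vertex (2/3,2/3,0)\<close>

text \<open>A dyadic substitute for \<open>min ((D/m) powr (2/3)) ((D/m) powr (4/3))\<close>.\<close>
definition dyadic_weight :: "real \<Rightarrow> real \<Rightarrow> ennreal" where
  "dyadic_weight D m = (\<Sum>j. ennreal (4 ^ j) * indicator {..D / 8 ^ j} m
      + ennreal (1 / 16 ^ j) * indicator {..8 * 8 ^ j * D} m)"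

lemma borel_measurable_dyadic_weight [measurable (raw)]:
  assumes [measurable]: "f \<in> borel_measurable M" "g \<in> borel_measurable M"
  shows "(\<lambda>x. dyadic_weight (f x) (g x)) \<in> borel_measurable M"
  unfolding dyadic_weight_def indicator_def atMost_iff by measurable

lemma dyadic_weight_ge:
  shows "m \<le> D / 8 ^ j \<Longrightarrow> ennreal (4 ^ j) \<le> dyadic_weight D m"
    and "m \<le> 8 * 8 ^ j * D \<Longrightarrow> ennreal (1 / 16 ^ j) \<le> dyadic_weight D m"
proof -
  let ?f = "\<lambda>j. ennreal (4 ^ j) * indicator {..D / 8 ^ j} m
      + ennreal (1 / 16 ^ j) * indicator {..8 * 8 ^ j * D} m"
  have *: "?f j \<le> dyadic_weight D m"
    using sum_le_suminf[of ?f "{j}"] unfolding dyadic_weight_def by (simp add: summableI)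
  show "ennreal (4 ^ j) \<le> dyadic_weight D m" if "m \<le> D / 8 ^ j"
    using that by (intro order_trans[OF _ *]) simp
  show "ennreal (1 / 16 ^ j) \<le> dyadic_weight D m" if "m \<le> 8 * 8 ^ j * D"
    using that by (intro order_trans[OF _ *]) simp
qed

text \<open>At \<open>m = 0\<close> every term \<open>4 ^ j\<close> is switched on. This disposes of
  triples with a vanishing determinant, for which the ratio has no dyadic size.\<close>

lemma dyadic_weight_zero:
  assumes "0 \<le> D"
  shows "dyadic_weight D 0 = \<infinity>"
proof (rule ccontr)
  assume "dyadic_weight D 0 \<noteq> \<infinity>"
  then obtain r where r: "0 \<le> r" "dyadic_weight D 0 = ennreal r"
    by (cases "dyadic_weight D 0") auto
  obtain j where "r < 4 ^ j" using real_arch_pow[of 4 r] by auto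
  moreover have "ennreal (4 ^ j) \<le> ennreal r"
    using dyadic_weight_ge(1)[of 0 D j] assms r by simp
  ultimately show False using r by simp
qed

text \<open>If \<open>8 ^ j\<close> is the dyadic size of \<open>M2 / m\<close>, the three weights are at least
  \<open>1 / 16 ^ j\<close>, \<open>4 ^ j\<close> and \<open>4 ^ j\<close>, whose product is 1.\<close>
lemma le_dyadic_weight_sum:
  fixes A B C X m M1 M2 :: real
  assumes m: "0 \<le> m" "m \<le> M2" "M2 \<le> M1"
    and nn: "0 \<le> A" "0 \<le> B" "0 \<le> C" "0 \<le> X" and X: "X ^ 3 = A * B * C"
  shows "ennreal X \<le> dyadic_weight m M2 * ennreal A + dyadic_weight M2 m * ennreal B + dyadic_weight M1 m * ennreal C"
proof (cases "m = 0")
  case True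
  show ?thesis
  proof (cases "C = 0")
    case True
    then have "X = 0" using X by simp
    then show ?thesis by simp
  next
    case False
    then show ?thesis
      using True m nn dyadic_weight_zero[of M1] by (simp add: ennreal_top_mult)
  qed
next
  case False
  then have m0: "0 < m" using m by simp
  obtain i where "M2 / m < 8 ^ i" using real_arch_pow[of 8 "M2 / m"] by auto
  then have ex: "M2 \<le> 8 * 8 ^ i * m" using m0 m by (simp add: field_simps)
  \<comment> \<open>Minimality yields \<open>8 ^ j * m \<le> M2\<close>, while membership loses a
    factor 8; that factor is the additional 8 in the second indicator of
    \<open>dyadic_weight\<close>.\<close>
  define j where "j = (LEAST j. M2 \<le> 8 * 8 ^ j * m)"
  have j1: "M2 \<le> 8 * 8 ^ j * m" unfolding j_def using ex by (rule LeastI)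
  have j2: "m \<le> M2 / 8 ^ j"
  proof (cases j)
    case (Suc k)
    then have "\<not> M2 \<le> 8 * 8 ^ k * m" unfolding j_def by (intro not_less_Least) simp
    then show ?thesis using Suc by (simp add: field_simps)
  qed (use m in simp)
  have j3: "m \<le> M1 / 8 ^ j" using j2 m by (meson divide_right_mono order_trans zero_le_numeral zero_le_power)
  \<comment> \<open>If all three alternatives failed, the product of the strict inequalities would
    read \<open>A * B * C < X ^ 3\<close>, because the powers of 4 and 16 cancel.\<close>
  have "X \<le> 1 / 16 ^ j * A \<or> X \<le> 4 ^ j * B \<or> X \<le> 4 ^ j * C"
  proof (rule ccontr)
    assume "\<not> ?thesis"
    then have l: "1 / 16 ^ j * A < X" "4 ^ j * B < X" "4 ^ j * C < X" by auto
    have p: "(1 / 16 ^ j * A) * (4 ^ j * B) < X * X"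
      using l nn by (intro mult_strict_mono') auto
    have "((1 / 16 ^ j * A) * (4 ^ j * B)) * (4 ^ j * C) < (X * X) * X"
      using l p nn by (intro mult_strict_mono') auto
    moreover have "((1 / 16 ^ j * A) * (4 ^ j * B)) * (4 ^ j * C) = A * B * C"
    proof -
      have "(16::real) ^ j = 4 ^ j * 4 ^ j" by (simp add: power_mult_distrib[symmetric])
      then show ?thesis by simp
    qed
    ultimately show False using X by (simp add: power3_eq_cube)
  qed
  moreover have "ennreal (1 / 16 ^ j * A) \<le> dyadic_weight m M2 * ennreal A"
    using dyadic_weight_ge(2)[OF j1] nn by (subst ennreal_mult) (auto intro!: mult_right_mono)
  moreover have "ennreal (4 ^ j * B) \<le> dyadic_weight M2 m * ennreal B"
    using dyadic_weight_ge(1)[OF j2] nn by (subst ennreal_mult) (auto intro!: mult_right_mono)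
  moreover have "ennreal (4 ^ j * C) \<le> dyadic_weight M1 m * ennreal C"
    using dyadic_weight_ge(1)[OF j3] nn by (subst ennreal_mult) (auto intro!: mult_right_mono)
  ultimately show ?thesis
    by (elim disjE) (auto dest!: ennreal_leI intro: order_trans add_increasing add_increasing2)
qed

text \<open>The cube of the left side is the product of the three cubes of pairs, so the ordered
  inequality applies to each of the six orders of the determinants. Summing two comparisons in
  \<open>W\<close> makes the weights independent of the order, and in each term the third point
  enters only through its determinants with the pair.\<close>

lemma square_prod_le_dyadic_weight:
  fixes a b c :: real
  assumes d: "0 \<le> d12" "0 \<le> d13" "0 \<le> d23" and nn: "0 \<le> a" "0 \<le> b" "0 \<le> c"
  defines "W \<equiv> \<lambda>D d e. dyadic_weight D d + dyadic_weight D e"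
  shows "ennreal ((a * b * c)\<^sup>2) \<le> W d12 d13 d23 * ennreal ((a * b) ^ 3)
      + W d13 d12 d23 * ennreal ((a * c) ^ 3) + W d23 d12 d13 * ennreal ((b * c) ^ 3)"
proof -
  have W: "dyadic_weight D d \<le> W D d e" "dyadic_weight D e \<le> W D d e" for D d e
    by (auto simp: W_def add.commute)
  have core: "ennreal X \<le> Wm * ennreal A + W2 * ennreal B + W1 * ennreal C"
    if "0 \<le> m" "m \<le> M2" "M2 \<le> M1" "0 \<le> A" "0 \<le> B" "0 \<le> C" "0 \<le> X" "X ^ 3 = A * B * C"
      "dyadic_weight m M2 \<le> Wm" "dyadic_weight M2 m \<le> W2" "dyadic_weight M1 m \<le> W1"
    for A B C X m M1 M2 Wm W1 W2
    by (rule order_trans[OF le_dyadic_weight_sum[of m M2 M1 A B C X]])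
       (use that in \<open>auto intro!: add_mono mult_right_mono\<close>)
  let ?X = "(a * b * c)\<^sup>2" and ?A = "(a * b) ^ 3" and ?B = "(a * c) ^ 3" and ?C = "(b * c) ^ 3"
  have eq: "?X ^ 3 = ?A * ?B * ?C" "?X ^ 3 = ?A * ?C * ?B" "?X ^ 3 = ?B * ?A * ?C"
     "?X ^ 3 = ?B * ?C * ?A" "?X ^ 3 = ?C * ?A * ?B" "?X ^ 3 = ?C * ?B * ?A"
    by (simp_all add: power2_eq_square power3_eq_cube algebra_simps)
  consider "d12 \<le> d13" "d13 \<le> d23" | "d12 \<le> d23" "d23 \<le> d13" | "d13 \<le> d12" "d12 \<le> d23"
    | "d13 \<le> d23" "d23 \<le> d12" | "d23 \<le> d12" "d12 \<le> d13" | "d23 \<le> d13" "d13 \<le> d12" by linarith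
  then show ?thesis
  proof cases
    case 1 then show ?thesis
      using core[of d12 d13 d23 ?A ?B ?C ?X "W d12 d13 d23" "W d13 d12 d23" "W d23 d12 d13"]
        eq d nn by (simp add: W add_ac)
  next
    case 2 then show ?thesis
      using core[of d12 d23 d13 ?A ?C ?B ?X "W d12 d13 d23" "W d23 d12 d13" "W d13 d12 d23"]
        eq d nn by (simp add: W add_ac)
  next
    case 3 then show ?thesis
      using core[of d13 d12 d23 ?B ?A ?C ?X "W d13 d12 d23" "W d12 d13 d23" "W d23 d12 d13"]
        eq d nn by (simp add: W add_ac)
  next
    case 4 then show ?thesis
      using core[of d13 d23 d12 ?B ?C ?A ?X "W d13 d12 d23" "W d23 d12 d13" "W d12 d13 d23"]
        eq d nn by (simp add: W add_ac)
  next
    case 5 then show ?thesis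
      using core[of d23 d12 d13 ?C ?A ?B ?X "W d23 d12 d13" "W d12 d13 d23" "W d13 d12 d23"]
        eq d nn by (simp add: W add_ac)
  next
    case 6 then show ?thesis
      using core[of d23 d13 d12 ?C ?B ?A ?X "W d23 d12 d13" "W d13 d12 d23" "W d12 d13 d23"]
        eq d nn by (simp add: W add_ac)
  qed
qed

lemma nn_integral_cube:
  assumes [measurable]: "P \<in> borel_measurable lborel"
  shows "(\<integral>\<^sup>+x. P x \<partial>lborel) ^ 3 = (\<integral>\<^sup>+p. \<integral>\<^sup>+q. \<integral>\<^sup>+r. P p * P q * P r \<partial>lborel \<partial>lborel \<partial>lborel)"
  by (simp add: nn_integral_cmult nn_integral_multc power3_eq_cube)

context thin_annulus
begin

text \<open>By the strip estimate level \<open>j\<close> contributes at most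
  \<open>32 * D / 2 ^ j\<close> from the first indicator and \<open>256 * D / 2 ^ j\<close> from the
  second. The geometric series returns a multiple of \<open>D\<close> itself, which is the Jacobian
  missing for the other two points.\<close>

lemma nn_integral_sigma_dyadic_weight_le:
  assumes u: "1/2 \<le> norm u" and D: "0 \<le> D"
  shows "(\<integral>\<^sup>+z. \<sigma> z * dyadic_weight D \<bar>det2 u z\<bar> \<partial>lborel) \<le> ennreal (576 * D)"
proof -
  have "(\<integral>\<^sup>+z. \<sigma> z * dyadic_weight D \<bar>det2 u z\<bar> \<partial>lborel)
    = (\<integral>\<^sup>+z. (\<Sum>j. ennreal (4 ^ j) * (\<sigma> z * indicator {..D / 8 ^ j} \<bar>det2 u z\<bar>)
      + ennreal (1 / 16 ^ j) * (\<sigma> z * indicator {..8 * 8 ^ j * D} \<bar>det2 u z\<bar>)) \<partial>lborel)"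
    unfolding dyadic_weight_def ennreal_suminf_cmult[symmetric]
    by (simp add: distrib_left mult_ac)
  also have "\<dots> = (\<Sum>j. \<integral>\<^sup>+z. (ennreal (4 ^ j) * (\<sigma> z * indicator {..D / 8 ^ j} \<bar>det2 u z\<bar>)
      + ennreal (1 / 16 ^ j) * (\<sigma> z * indicator {..8 * 8 ^ j * D} \<bar>det2 u z\<bar>)) \<partial>lborel)"
    by (rule nn_integral_suminf) measurable
  also have "\<dots> = (\<Sum>j. ennreal (4 ^ j) * (\<integral>\<^sup>+z. \<sigma> z * indicator {..D / 8 ^ j} \<bar>det2 u z\<bar> \<partial>lborel)
      + ennreal (1 / 16 ^ j) * (\<integral>\<^sup>+z. \<sigma> z * indicator {..8 * 8 ^ j * D} \<bar>det2 u z\<bar> \<partial>lborel))"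
    by (simp add: nn_integral_add nn_integral_cmult)
  also have "\<dots> \<le> (\<Sum>j. ennreal (288 * D * (1/2) ^ j))"
  proof (rule suminf_le)
    fix j
    have "ennreal (4 ^ j) * (\<integral>\<^sup>+z. \<sigma> z * indicator {..D / 8 ^ j} \<bar>det2 u z\<bar> \<partial>lborel)
      + ennreal (1 / 16 ^ j) * (\<integral>\<^sup>+z. \<sigma> z * indicator {..8 * 8 ^ j * D} \<bar>det2 u z\<bar> \<partial>lborel)
      \<le> ennreal (4 ^ j) * ennreal (32 * (D / 8 ^ j)) + ennreal (1 / 16 ^ j) * ennreal (32 * (8 * 8 ^ j * D))"
      by (intro add_mono mult_left_mono nn_integral_sigma_strip_le u) (use D in auto)
    also have "\<dots> = ennreal (4 ^ j * (32 * (D / 8 ^ j)) + 1 / 16 ^ j * (32 * (8 * 8 ^ j * D)))"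
      using D by (simp add: ennreal_mult[symmetric] ennreal_plus[symmetric] del: ennreal_plus)
    also have "4 ^ j * (32 * (D / 8 ^ j)) + 1 / 16 ^ j * (32 * (8 * 8 ^ j * D)) = 288 * D * (1/2) ^ j"
    proof -
      have "(8::real) ^ j = 4 ^ j * 2 ^ j" "(16::real) ^ j = 4 ^ j * 2 ^ j * 2 ^ j"
        by (simp_all add: power_mult_distrib[symmetric])
      then show ?thesis by (simp add: field_simps)
    qed
    finally show "ennreal (4 ^ j) * (\<integral>\<^sup>+z. \<sigma> z * indicator {..D / 8 ^ j} \<bar>det2 u z\<bar> \<partial>lborel)
      + ennreal (1 / 16 ^ j) * (\<integral>\<^sup>+z. \<sigma> z * indicator {..8 * 8 ^ j * D} \<bar>det2 u z\<bar> \<partial>lborel)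
      \<le> ennreal (288 * D * (1/2) ^ j)" .
  qed (simp_all add: summableI)
  also have "\<dots> = ennreal (288 * D * 2)"
    using D geometric_sums[of "1/2::real"] by (intro suminf_ennreal_eq sums_mult) auto
  finally show ?thesis by simp
qed

text \<open>Cubing the convolution and distributing the weights according to the smallest of the three angles
  between the points reduces the endpoint estimate to the bilinear one.\<close>
lemma nn_integral_circular_mean_cube_le:
  assumes [measurable]: "h \<in> borel_measurable borel" and nn: "\<And>x. 0 \<le> h x"
    and h: "(\<integral>\<^sup>+x. ennreal (h x ^ 3) \<partial>lborel) \<le> 1"
  shows "(\<integral>\<^sup>+x. (\<integral>\<^sup>+y. \<sigma> (y - x) * ennreal ((h y)\<^sup>2) \<partial>lborel) ^ 3 \<partial>lborel) \<le> 13824"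
proof -
  define H where "H y = ennreal (h y ^ 3)" for y
  have [measurable]: "H \<in> borel_measurable borel" unfolding H_def by measurable
  define d where "d x p q = \<bar>det2 (p - x) (q - x)\<bar>" for x p q
  have [measurable]: "(\<lambda>x. d (f x) (g x) (h x)) \<in> borel_measurable M"
    if [measurable]: "f \<in> borel_measurable M" "g \<in> borel_measurable M" "h \<in> borel_measurable M"
    for f g h and M :: "'b measure"
    unfolding d_def by measurable
  have d_commute: "d x p q = d x q p" for x p q by (simp add: d_def det2_commute[of "p - x"])
  define \<Phi> where "\<Phi> x p q r = \<sigma> (p - x) * (H p * (\<sigma> (q - x) * (H q *
     (\<sigma> (r - x) * (dyadic_weight (d x p q) (d x p r) + dyadic_weight (d x p q) (d x q r))))))" for x p q r
  have [measurable]: "(\<lambda>x. \<Phi> (e x) (f x) (g x) (h x)) \<in> borel_measurable M"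
    if [measurable]: "e \<in> borel_measurable M" "f \<in> borel_measurable M" "g \<in> borel_measurable M" "h \<in> borel_measurable M"
    for e f g h and M :: "'b measure"
    unfolding \<Phi>_def by measurable
  define E where "E x = (\<integral>\<^sup>+p. \<sigma> (p - x) * (H p * (\<integral>\<^sup>+q. \<sigma> (q - x) * (H q * ennreal (d x p q)) \<partial>lborel)) \<partial>lborel)" for x
  have [measurable]: "E \<in> borel_measurable borel" unfolding E_def by measurable
  have wt: "(\<integral>\<^sup>+r. \<sigma> (r - x) * dyadic_weight D (d x p r) \<partial>lborel) \<le> ennreal (576 * D)"
    if "\<sigma> (p - x) \<noteq> 0" "0 \<le> D" for x p D
  proof -
    have "(\<integral>\<^sup>+r. \<sigma> (r - x) * dyadic_weight D (d x p r) \<partial>lborel)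
        = (\<integral>\<^sup>+z. \<sigma> ((x + z) - x) * dyadic_weight D (d x p (x + z)) \<partial>lborel)"
      by (rule nn_integral_lborel_plus[symmetric]) measurable
    also have "\<dots> \<le> ennreal (576 * D)"
      unfolding d_def using nn_integral_sigma_dyadic_weight_le[of "p - x" D] sigma_norm_bounds[OF that(1)] that
      by simp
    finally show ?thesis .
  qed
  \<comment> \<open>Integration in \<open>r\<close> returns the determinant of \<open>p\<close> and
    \<open>q\<close> once for each of the two comparisons, hence \<open>1152 = 2 * 576\<close>; what
    remains is the bilinear form with its Jacobian.\<close>
  have \<Phi>E: "(\<integral>\<^sup>+p. \<integral>\<^sup>+q. \<integral>\<^sup>+r. \<Phi> x p q r \<partial>lborel \<partial>lborel \<partial>lborel) \<le> 1152 * E x" for x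
  proof -
    have "(\<integral>\<^sup>+p. \<integral>\<^sup>+q. \<integral>\<^sup>+r. \<Phi> x p q r \<partial>lborel \<partial>lborel \<partial>lborel)
       \<le> (\<integral>\<^sup>+p. \<integral>\<^sup>+q. \<sigma> (p - x) * (H p * (\<sigma> (q - x) * (H q * (1152 * ennreal (d x p q))))) \<partial>lborel \<partial>lborel)"
    proof (intro nn_integral_mono)
      fix p q
      show "(\<integral>\<^sup>+r. \<Phi> x p q r \<partial>lborel) \<le> \<sigma> (p - x) * (H p * (\<sigma> (q - x) * (H q * (1152 * ennreal (d x p q)))))"
      proof (cases "\<sigma> (p - x) = 0 \<or> \<sigma> (q - x) = 0")
        case False
        have d0: "0 \<le> d x p q" by (simp add: d_def)
        have "(\<integral>\<^sup>+r. \<sigma> (r - x) * (dyadic_weight (d x p q) (d x p r) + dyadic_weight (d x p q) (d x q r)) \<partial>lborel)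
          = (\<integral>\<^sup>+r. \<sigma> (r - x) * dyadic_weight (d x p q) (d x p r) \<partial>lborel)
          + (\<integral>\<^sup>+r. \<sigma> (r - x) * dyadic_weight (d x p q) (d x q r) \<partial>lborel)"
          by (simp add: distrib_left nn_integral_add)
        also have "\<dots> \<le> ennreal (576 * d x p q) + ennreal (576 * d x p q)"
          using False d0 by (intro add_mono wt) auto
        also have "\<dots> = 1152 * ennreal (d x p q)"
          using d0 by (simp add: ennreal_mult distrib_right[symmetric])
        finally show ?thesis unfolding \<Phi>_def
          by (simp add: nn_integral_cmult) (intro mult_left_mono; simp)
      qed (auto simp: \<Phi>_def)
    qed
    also have "\<dots> = 1152 * E x"
      unfolding E_def by (simp add: nn_integral_cmult[symmetric] mult_ac)
    finally show ?thesis .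
  qed
  have "(\<integral>\<^sup>+y. \<sigma> (y - x) * ennreal ((h y)\<^sup>2) \<partial>lborel) ^ 3 \<le> 3456 * E x" for x
  proof -
    let ?P = "\<lambda>y. \<sigma> (y - x) * ennreal ((h y)\<^sup>2)"
    have "(\<integral>\<^sup>+y. ?P y \<partial>lborel) ^ 3 = (\<integral>\<^sup>+p. \<integral>\<^sup>+q. \<integral>\<^sup>+r. ?P p * ?P q * ?P r \<partial>lborel \<partial>lborel \<partial>lborel)"
      by (rule nn_integral_cube) measurable
    also have "\<dots> \<le> (\<integral>\<^sup>+p. \<integral>\<^sup>+q. \<integral>\<^sup>+r. \<Phi> x p q r + \<Phi> x p r q + \<Phi> x q r p \<partial>lborel \<partial>lborel \<partial>lborel)"
    proof (intro nn_integral_mono)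
      fix p q r
      have "ennreal ((h p * h q * h r)\<^sup>2)
        \<le> (dyadic_weight (d x p q) (d x p r) + dyadic_weight (d x p q) (d x q r)) * ennreal ((h p * h q) ^ 3)
        + (dyadic_weight (d x p r) (d x p q) + dyadic_weight (d x p r) (d x q r)) * ennreal ((h p * h r) ^ 3)
        + (dyadic_weight (d x q r) (d x p q) + dyadic_weight (d x q r) (d x p r)) * ennreal ((h q * h r) ^ 3)"
        (is "?L \<le> ?R")
        by (rule square_prod_le_dyadic_weight) (use nn in \<open>auto simp: d_def\<close>)
      then have "\<sigma> (p - x) * \<sigma> (q - x) * \<sigma> (r - x) * ?L \<le> \<sigma> (p - x) * \<sigma> (q - x) * \<sigma> (r - x) * ?R"
        by (rule mult_left_mono) simp
      moreover have "\<sigma> (p - x) * \<sigma> (q - x) * \<sigma> (r - x) * ?L = ?P p * ?P q * ?P r"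
        using nn by (simp add: power_mult_distrib ennreal_mult mult_ac)
      moreover have "\<sigma> (p - x) * \<sigma> (q - x) * \<sigma> (r - x) * ?R = \<Phi> x p q r + \<Phi> x p r q + \<Phi> x q r p"
        unfolding \<Phi>_def H_def d_commute[of x q p] d_commute[of x r p] d_commute[of x r q]
        using nn by (simp add: power_mult_distrib ennreal_mult distrib_left mult_ac)
      ultimately show "?P p * ?P q * ?P r \<le> \<Phi> x p q r + \<Phi> x p r q + \<Phi> x q r p" by simp
    qed
    also have "\<dots> = (\<integral>\<^sup>+p. \<integral>\<^sup>+q. \<integral>\<^sup>+r. \<Phi> x p q r \<partial>lborel \<partial>lborel \<partial>lborel)
      + (\<integral>\<^sup>+p. \<integral>\<^sup>+q. \<integral>\<^sup>+r. \<Phi> x p r q \<partial>lborel \<partial>lborel \<partial>lborel) + (\<integral>\<^sup>+p. \<integral>\<^sup>+q. \<integral>\<^sup>+r. \<Phi> x q r p \<partial>lborel \<partial>lborel \<partial>lborel)"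
      by (simp add: nn_integral_add)
    \<comment> \<open>The three choices of the distinguished pair differ only by the names of the
      variables, so Tonelli identifies their integrals.\<close>
    also have "(\<integral>\<^sup>+p. \<integral>\<^sup>+q. \<integral>\<^sup>+r. \<Phi> x p r q \<partial>lborel \<partial>lborel \<partial>lborel) = (\<integral>\<^sup>+p. \<integral>\<^sup>+q. \<integral>\<^sup>+r. \<Phi> x p q r \<partial>lborel \<partial>lborel \<partial>lborel)"
      by (intro nn_integral_cong lborel_pair.Fubini') measurable
    also have "(\<integral>\<^sup>+p. \<integral>\<^sup>+q. \<integral>\<^sup>+r. \<Phi> x q r p \<partial>lborel \<partial>lborel \<partial>lborel) = (\<integral>\<^sup>+q. \<integral>\<^sup>+p. \<integral>\<^sup>+r. \<Phi> x q r p \<partial>lborel \<partial>lborel \<partial>lborel)"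
      by (rule lborel_pair.Fubini') measurable
    also have "\<dots> = (\<integral>\<^sup>+p. \<integral>\<^sup>+q. \<integral>\<^sup>+r. \<Phi> x p q r \<partial>lborel \<partial>lborel \<partial>lborel)"
      by (intro nn_integral_cong lborel_pair.Fubini') measurable
    also have "(\<integral>\<^sup>+p. \<integral>\<^sup>+q. \<integral>\<^sup>+r. \<Phi> x p q r \<partial>lborel \<partial>lborel \<partial>lborel) + (\<integral>\<^sup>+p. \<integral>\<^sup>+q. \<integral>\<^sup>+r. \<Phi> x p q r \<partial>lborel \<partial>lborel \<partial>lborel)
        + (\<integral>\<^sup>+p. \<integral>\<^sup>+q. \<integral>\<^sup>+r. \<Phi> x p q r \<partial>lborel \<partial>lborel \<partial>lborel) \<le> 1152 * E x + 1152 * E x + 1152 * E x"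
      by (intro add_mono \<Phi>E)
    also have "\<dots> = 3456 * E x" by (simp add: distrib_right[symmetric])
    finally show ?thesis .
  qed
  then have "(\<integral>\<^sup>+x. (\<integral>\<^sup>+y. \<sigma> (y - x) * ennreal ((h y)\<^sup>2) \<partial>lborel) ^ 3 \<partial>lborel) \<le> (\<integral>\<^sup>+x. 3456 * E x \<partial>lborel)"
    by (rule nn_integral_mono)
  also have "\<dots> = 3456 * (\<integral>\<^sup>+x. E x \<partial>lborel)" by (rule nn_integral_cmult) measurable
  also have "\<dots> \<le> 3456 * (4 * (\<integral>\<^sup>+x. H x \<partial>lborel) * (\<integral>\<^sup>+x. H x \<partial>lborel))"
    unfolding E_def d_def by (intro mult_left_mono nn_integral_bilinear_det2_le) auto
  also have "\<dots> \<le> 3456 * (4 * 1 * 1)"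
    using h unfolding H_def by (intro mult_left_mono mult_mono) auto
  finally show ?thesis by simp
qed

text \<open>The L^{3/2} functions are written as squares of L^3 functions so that only integer
  powers occur. The bounded \<open>H\<close> sits on a vertex that is integrated out, which leaves
  the pairing of the first function with a circular mean of the second.\<close>

lemma Lam_two_thirds_two_thirds_zero_le:
  assumes [measurable]: "f \<in> borel_measurable borel" "h \<in> borel_measurable borel" "H \<in> borel_measurable borel"
    and nn: "\<And>x. 0 \<le> f x" "\<And>x. 0 \<le> h x" and H: "\<And>x. H x \<le> 1"
    and f: "(\<integral>\<^sup>+x. ennreal (f x ^ 3) \<partial>lborel) \<le> 1" and h: "(\<integral>\<^sup>+x. ennreal (h x ^ 3) \<partial>lborel) \<le> 1"
  shows "Lam (\<lambda>x. ennreal ((f x)\<^sup>2)) (\<lambda>x. ennreal ((h x)\<^sup>2)) H \<le> 110600"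
proof -
  define T where "T x = (\<integral>\<^sup>+y. \<sigma> (y - x) * ennreal ((h y)\<^sup>2) \<partial>lborel)" for x
  have [measurable]: "T \<in> borel_measurable borel" unfolding T_def by measurable
  have "Lam (\<lambda>x. ennreal ((f x)\<^sup>2)) (\<lambda>x. ennreal ((h x)\<^sup>2)) H
     = Lam (\<lambda>x. ennreal ((f x)\<^sup>2)) H (\<lambda>x. ennreal ((h x)\<^sup>2))"
    by (rule Lam_swap23) measurable
  also have "\<dots> = Lam H (\<lambda>x. ennreal ((h x)\<^sup>2)) (\<lambda>x. ennreal ((f x)\<^sup>2))"
    by (subst Lam_swap12, measurable, rule Lam_swap23) measurable
  also have "\<dots> \<le> (\<integral>\<^sup>+z. ennreal ((f z)\<^sup>2) * (8 * T z) \<partial>lborel)"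
  proof (subst Lam_eq_K, measurable, intro nn_integral_mono mult_left_mono)
    fix z
    have "(\<integral>\<^sup>+x. \<integral>\<^sup>+y. K z x y * H x * ennreal ((h y)\<^sup>2) \<partial>lborel \<partial>lborel)
      \<le> (\<integral>\<^sup>+x. \<integral>\<^sup>+y. K z x y * 1 * ennreal ((h y)\<^sup>2) \<partial>lborel \<partial>lborel)"
      by (intro nn_integral_mono mult_mono H) auto
    also have "\<dots> \<le> 8 * T z"
      using nn_integral_K_snd_le[of "\<lambda>y. ennreal ((h y)\<^sup>2)" z] by (simp add: T_def)
    finally show "(\<integral>\<^sup>+x. \<integral>\<^sup>+y. K z x y * H x * ennreal ((h y)\<^sup>2) \<partial>lborel \<partial>lborel) \<le> 8 * T z" .
  qed simp
  also have "\<dots> \<le> (\<integral>\<^sup>+z. 8 * (ennreal (f z ^ 3) + T z ^ 3) \<partial>lborel)"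
  proof (rule nn_integral_mono)
    fix z
    \<comment> \<open>Young's inequality for the exponents 3/2 and 3, obtained without a sharp
      constant by comparing \<open>T z\<close> with \<open>f z\<close>.\<close>
    have "ennreal ((f z)\<^sup>2) * T z \<le> ennreal (f z ^ 3) + T z ^ 3"
    proof (cases "T z \<le> ennreal (f z)")
      case True
      then have "ennreal ((f z)\<^sup>2) * T z \<le> ennreal ((f z)\<^sup>2) * ennreal (f z)" by (rule mult_left_mono) simp
      also have "\<dots> = ennreal (f z ^ 3)"
        using nn by (simp add: ennreal_mult[symmetric] power3_eq_cube power2_eq_square)
      finally show ?thesis by (rule order_trans) simp
    next
      case False
      then have "ennreal (f z) * ennreal (f z) * T z \<le> T z * T z * T z"
        by (intro mult_mono) auto
      then have "ennreal ((f z)\<^sup>2) * T z \<le> T z ^ 3"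
        using nn by (simp add: ennreal_mult power2_eq_square power3_eq_cube)
      then show ?thesis by (rule order_trans) simp
    qed
    then have "8 * (ennreal ((f z)\<^sup>2) * T z) \<le> 8 * (ennreal (f z ^ 3) + T z ^ 3)" by (rule mult_left_mono) simp
    then show "ennreal ((f z)\<^sup>2) * (8 * T z) \<le> 8 * (ennreal (f z ^ 3) + T z ^ 3)"
      by (simp add: mult.left_commute)
  qed
  also have "\<dots> = 8 * ((\<integral>\<^sup>+z. ennreal (f z ^ 3) \<partial>lborel) + (\<integral>\<^sup>+z. T z ^ 3 \<partial>lborel))"
    by (simp add: nn_integral_cmult nn_integral_add del: distrib_left_numeral)
  also have "\<dots> \<le> 8 * (1 + 13824)"
    using f nn_integral_circular_mean_cube_le[OF assms(2) nn(2) h]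
    unfolding T_def by (intro mult_left_mono add_mono) auto
  finally show ?thesis by simp
qed

end

section \<open>Convexity of the set of admissible exponents\<close>

text \<open>Norm at most 1, in a form that holds for Borel functions and everywhere: at
  \<open>t = 0\<close> a pointwise bound stands for the essential supremum. Exceptional null sets
  are removed once, on passing to general functions.\<close>

definition unit_norm :: "real \<Rightarrow> (real^2 \<Rightarrow> real) \<Rightarrow> bool" where
  "unit_norm t f \<longleftrightarrow> f \<in> borel_measurable borel \<and> (\<forall>x. 0 \<le> f x) \<and>
     (if t = 0 then \<forall>x. f x \<le> 1 else (\<integral>\<^sup>+x. ennreal (f x powr (1 / t)) \<partial>lborel) \<le> 1)"

text \<open>The bound concerns each \<epsilon> with one constant rather than the upper limit, so
  permutation and convex combination are carried out at a fixed \<epsilon>.\<close>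

definition bounded_exponents :: "(real \<times> real \<times> real) set" where
  "bounded_exponents = {(a, b, c). 0 \<le> a \<and> 0 \<le> b \<and> 0 \<le> c \<and>
     (\<exists>C::real. \<forall>\<epsilon> f g h. 0 < \<epsilon> \<and> \<epsilon> \<le> 1/20 \<and> unit_norm a f \<and> unit_norm b g \<and> unit_norm c h
        \<longrightarrow> Lambda_eps \<epsilon> f g h \<le> ennreal C)}"

lemma bounded_exponentsI:
  assumes "0 \<le> a" "0 \<le> b" "0 \<le> c"
    and "\<And>\<epsilon> f g h. thin_annulus \<epsilon> \<Longrightarrow> unit_norm a f \<Longrightarrow> unit_norm b g \<Longrightarrow> unit_norm c h
      \<Longrightarrow> Lambda_eps \<epsilon> f g h \<le> ennreal C"
  shows "(a, b, c) \<in> bounded_exponents"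
  using assms unfolding bounded_exponents_def thin_annulus_def by blast

lemma bounded_exponentsE:
  assumes "(a, b, c) \<in> bounded_exponents"
  obtains C where "0 \<le> a" "0 \<le> b" "0 \<le> c" "1 \<le> C"
    "\<And>\<epsilon> f g h. thin_annulus \<epsilon> \<Longrightarrow> unit_norm a f \<Longrightarrow> unit_norm b g \<Longrightarrow> unit_norm c h
      \<Longrightarrow> Lambda_eps \<epsilon> f g h \<le> ennreal C"
proof -
  from assms obtain C where nn: "0 \<le> a" "0 \<le> b" "0 \<le> c" and C: "\<And>\<epsilon> f g h. 0 < \<epsilon> \<Longrightarrow> \<epsilon> \<le> 1/20 \<Longrightarrow>
      unit_norm a f \<Longrightarrow> unit_norm b g \<Longrightarrow> unit_norm c h \<Longrightarrow> Lambda_eps \<epsilon> f g h \<le> ennreal C"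
    unfolding bounded_exponents_def by blast
  show ?thesis
  \<comment> \<open>A constant of at least 1 is nonzero, so that its product with nonzero norms, one
    of them infinite, is infinite.\<close>
  proof (rule that[of "max 1 C"])
    show "Lambda_eps \<epsilon> f g h \<le> ennreal (max 1 C)"
      if "thin_annulus \<epsilon>" "unit_norm a f" "unit_norm b g" "unit_norm c h" for \<epsilon> f g h
      by (rule order_trans[OF C ennreal_leI]) (use that in \<open>auto simp: thin_annulus_def\<close>)
  qed (use nn in auto)
qed

lemma unit_normD:
  assumes "unit_norm t f"
  shows "f \<in> borel_measurable borel" "0 \<le> f x" "t = 0 \<Longrightarrow> f x \<le> 1"
    "t \<noteq> 0 \<Longrightarrow> (\<integral>\<^sup>+x. ennreal (f x powr (1 / t)) \<partial>lborel) \<le> 1"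
  using assms by (auto simp: unit_norm_def)

lemma (in thin_annulus) Lambda_eps_swap12:
  assumes [measurable]: "f \<in> borel_measurable borel" "g \<in> borel_measurable borel" "h \<in> borel_measurable borel"
  shows "Lambda_eps \<epsilon> f g h = Lambda_eps \<epsilon> g f h"
  unfolding Lambda_eps_eq_Lam by (rule Lam_swap12) measurable

lemma (in thin_annulus) Lambda_eps_swap23:
  assumes [measurable]: "f \<in> borel_measurable borel" "g \<in> borel_measurable borel" "h \<in> borel_measurable borel"
  shows "Lambda_eps \<epsilon> f g h = Lambda_eps \<epsilon> f h g"
  unfolding Lambda_eps_eq_Lam by (rule Lam_swap23) measurable

lemma bounded_exponents_swap12:
  assumes "(a, b, c) \<in> bounded_exponents"
  shows "(b, a, c) \<in> bounded_exponents"
proof -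
  obtain C where *: "0 \<le> a" "0 \<le> b" "0 \<le> c"
    "\<And>\<epsilon> f g h. thin_annulus \<epsilon> \<Longrightarrow> unit_norm a f \<Longrightarrow> unit_norm b g \<Longrightarrow> unit_norm c h
      \<Longrightarrow> Lambda_eps \<epsilon> f g h \<le> ennreal C"
    using bounded_exponentsE[OF assms] by metis
  show ?thesis
  proof (rule bounded_exponentsI[where C = C])
    fix \<epsilon> f g h
    assume e: "thin_annulus \<epsilon>" and n: "unit_norm b f" "unit_norm a g" "unit_norm c h"
    have "Lambda_eps \<epsilon> f g h = Lambda_eps \<epsilon> g f h"
      using n by (intro thin_annulus.Lambda_eps_swap12[OF e] unit_normD(1))
    then show "Lambda_eps \<epsilon> f g h \<le> ennreal C" using *(4) e n by simp
  qed (use * in auto)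
qed

lemma bounded_exponents_swap23:
  assumes "(a, b, c) \<in> bounded_exponents"
  shows "(a, c, b) \<in> bounded_exponents"
proof -
  obtain C where *: "0 \<le> a" "0 \<le> b" "0 \<le> c"
    "\<And>\<epsilon> f g h. thin_annulus \<epsilon> \<Longrightarrow> unit_norm a f \<Longrightarrow> unit_norm b g \<Longrightarrow> unit_norm c h
      \<Longrightarrow> Lambda_eps \<epsilon> f g h \<le> ennreal C"
    using bounded_exponentsE[OF assms] by metis
  show ?thesis
  proof (rule bounded_exponentsI[where C = C])
    fix \<epsilon> f g h
    assume e: "thin_annulus \<epsilon>" and n: "unit_norm a f" "unit_norm c g" "unit_norm b h"
    have "Lambda_eps \<epsilon> f g h = Lambda_eps \<epsilon> f h g"
      using n by (intro thin_annulus.Lambda_eps_swap23[OF e] unit_normD(1))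
    then show "Lambda_eps \<epsilon> f g h \<le> ennreal C" using *(4) e n by simp
  qed (use * in auto)
qed

lemma bounded_exponents_one_zero_zero: "(1, 0, 0) \<in> bounded_exponents"
proof (rule bounded_exponentsI[where C = 64])
  fix \<epsilon> f g h
  assume "thin_annulus \<epsilon>" and f: "unit_norm 1 f" and g: "unit_norm 0 g" and h: "unit_norm 0 h"
  interpret thin_annulus \<epsilon> by fact
  note [measurable] = f[THEN unit_normD(1)] g[THEN unit_normD(1)] h[THEN unit_normD(1)]
  show "Lambda_eps \<epsilon> f g h \<le> ennreal 64"
    unfolding Lambda_eps_eq_Lam ennreal_numeral
    by (rule Lam_one_zero_zero_le)
       (use f g h in \<open>auto simp: ennreal_le_1 unit_norm_def\<close>)
qed auto

text \<open>The bound is for all functions with square integral at most 1, not for indicators alone;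
  in this strong form the vertex can enter convex combinations on the same footing as the
  others.\<close>

lemma bounded_exponents_half: "(1/2, 1/2, 1/2) \<in> bounded_exponents"
proof (rule bounded_exponentsI[where C = 8193])
  fix \<epsilon> f g h
  assume "thin_annulus \<epsilon>" and f: "unit_norm (1/2) f" and g: "unit_norm (1/2) g" and h: "unit_norm (1/2) h"
  interpret thin_annulus \<epsilon> by fact
  note [measurable] = f[THEN unit_normD(1)] g[THEN unit_normD(1)] h[THEN unit_normD(1)]
  have sq: "(\<integral>\<^sup>+x. ennreal (f x) * ennreal (f x) \<partial>lborel) \<le> 1" if "unit_norm (1/2) f" for f
    using unit_normD(2,4)[OF that] by (simp add: power2_eq_square ennreal_mult)
  show "Lambda_eps \<epsilon> f g h \<le> ennreal 8193"
    unfolding Lambda_eps_eq_Lam ennreal_numeral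
    by (rule Lam_half_half_half_le) (use f g h in \<open>auto intro: sq\<close>)
qed auto

lemma bounded_exponents_two_thirds: "(2/3, 2/3, 0) \<in> bounded_exponents"
proof (rule bounded_exponentsI[where C = 110600])
  fix \<epsilon> f g h
  assume "thin_annulus \<epsilon>" and f: "unit_norm (2/3) f" and g: "unit_norm (2/3) g" and h: "unit_norm 0 h"
  interpret thin_annulus \<epsilon> by fact
  note [measurable] = f[THEN unit_normD(1)] g[THEN unit_normD(1)] h[THEN unit_normD(1)]
  \<comment> \<open>The square root converts the normalization in L^{3/2} into the one in
    L^3.\<close>
  have cube: "sqrt y ^ 3 = y powr (3/2)" if "0 \<le> y" for y :: real
    using that by (cases "y = 0") (simp_all add: powr_half_sqrt[symmetric] powr_power)
  have sq: "(\<integral>\<^sup>+x. ennreal (sqrt (f x) ^ 3) \<partial>lborel) \<le> 1" if "unit_norm (2/3) f" for f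
    using unit_normD(2,4)[OF that] by (simp add: cube)
  have "Lam (\<lambda>x. ennreal ((sqrt (f x))\<^sup>2)) (\<lambda>x. ennreal ((sqrt (g x))\<^sup>2)) (\<lambda>x. ennreal (h x)) \<le> 110600"
    by (rule Lam_two_thirds_two_thirds_zero_le)
       (use f g h in \<open>auto intro: sq simp: ennreal_le_1 unit_norm_def\<close>)
  then show "Lambda_eps \<epsilon> f g h \<le> ennreal 110600"
    using f g unfolding Lambda_eps_eq_Lam ennreal_numeral by (simp add: unit_norm_def)
qed auto

lemma powr_mult_powr_le_add:
  fixes x y u v :: real
  assumes "0 \<le> x" "0 \<le> y" "0 \<le> u" "0 \<le> v" "u + v = 1"
  shows "x powr u * y powr v \<le> x + y"
proof -
  have "x powr u * y powr v \<le> max x y powr u * max x y powr v"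
    using assms by (intro mult_mono powr_mono2) auto
  also have "\<dots> = max x y" using assms by (simp add: powr_add[symmetric])
  also have "\<dots> \<le> x + y" using assms by auto
  finally show ?thesis .
qed

text \<open>With \<open>t = u * a + v * b\<close> the factors are the powers of \<open>f\<close>
  with exponents \<open>a / t\<close> and \<open>b / t\<close>: either one has the same normalized
  integral as \<open>f\<close>, and the exponents average to 1. If \<open>t = 0\<close>, then
  \<open>a = b = 0\<close> and \<open>f\<close> serves as both factors.\<close>

lemma unit_norm_interpolate:
  assumes f: "unit_norm (u * a + v * b) f" and nn: "0 \<le> a" "0 \<le> b" and uv: "0 < u" "0 < v" "u + v = 1"
  obtains g h where "unit_norm a g" "unit_norm b h" "\<And>x. f x = g x powr u * h x powr v"
proof -
  define t where "t = u * a + v * b"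
  have f0: "0 \<le> f x" for x using f by (rule unit_normD)
  have [measurable]: "f \<in> borel_measurable borel" using f by (rule unit_normD)
  show thesis
  proof (cases "t = 0")
    case True
    then have "u * a = 0" "v * b = 0"
      using nn uv by (auto simp: t_def add_nonneg_eq_0_iff)
    then have "a = 0" "b = 0" using uv by auto
    then show thesis
      using f f0 uv by (intro that[of f f]) (auto simp: powr_add[symmetric])
  next
    case False
    then have t: "t > 0" using nn uv by (simp add: t_def less_le)
    \<comment> \<open>For \<open>c = 0\<close> the power is the indicator of the set where
      \<open>f\<close> is nonzero, since \<open>0 powr 0 = 0\<close>; it is bounded by 1 as
      required.\<close>
    have pw: "unit_norm c (\<lambda>x. f x powr (c / t))" if "0 \<le> c" for c
      unfolding unit_norm_def
    proof (intro conjI allI)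
      show "if c = 0 then \<forall>x. f x powr (c / t) \<le> 1 else (\<integral>\<^sup>+x. ennreal ((f x powr (c / t)) powr (1 / c)) \<partial>lborel) \<le> 1"
        using f t by (auto simp: powr_powr unit_norm_def t_def[symmetric])
    qed auto
    have "f x = (f x powr (a / t)) powr u * (f x powr (b / t)) powr v" for x
    proof -
      have "a / t * u + b / t * v = (u * a + v * b) / t" by (simp add: add_divide_distrib mult.commute)
      then have "a / t * u + b / t * v = 1" using t by (simp add: t_def[symmetric])
      then show ?thesis using f0[of x] by (simp add: powr_powr powr_add[symmetric])
    qed
    then show thesis using pw nn by (intro that) auto
  qed
qed

text \<open>For a positive form, writing \<open>f = g powr u * h powr v\<close> in each argument makes the
  integrand at an intermediate exponent at most the sum of the integrands at the two end exponents.\<close>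
lemma convex_bounded_exponents: "convex bounded_exponents"
proof (rule convexI)
  fix p q :: "real \<times> real \<times> real" and u v :: real
  assume p: "p \<in> bounded_exponents" and q: "q \<in> bounded_exponents" and uv: "0 \<le> u" "0 \<le> v" "u + v = 1"
  show "u *\<^sub>R p + v *\<^sub>R q \<in> bounded_exponents"
  proof (cases "u = 0 \<or> v = 0")
    case True
    then show ?thesis using p q uv by auto
  next
    case False
    then have uv: "0 < u" "0 < v" "u + v = 1" using uv by auto
    obtain a1 a2 a3 b1 b2 b3 where pq: "p = (a1, a2, a3)" "q = (b1, b2, b3)" by (cases p, cases q) auto
    obtain C where a: "0 \<le> a1" "0 \<le> a2" "0 \<le> a3" "1 \<le> C"
      and C: "\<And>\<epsilon> f g h. thin_annulus \<epsilon> \<Longrightarrow> unit_norm a1 f \<Longrightarrow> unit_norm a2 g \<Longrightarrow> unit_norm a3 h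
        \<Longrightarrow> Lambda_eps \<epsilon> f g h \<le> ennreal C"
      using p unfolding pq by (elim bounded_exponentsE) (rule that)
    obtain D where b: "0 \<le> b1" "0 \<le> b2" "0 \<le> b3" "1 \<le> D"
      and D: "\<And>\<epsilon> f g h. thin_annulus \<epsilon> \<Longrightarrow> unit_norm b1 f \<Longrightarrow> unit_norm b2 g \<Longrightarrow> unit_norm b3 h
        \<Longrightarrow> Lambda_eps \<epsilon> f g h \<le> ennreal D"
      using q unfolding pq by (elim bounded_exponentsE) (rule that)
    have "(u * a1 + v * b1, u * a2 + v * b2, u * a3 + v * b3) \<in> bounded_exponents"
    proof (rule bounded_exponentsI[where C = "C + D"])
      fix \<epsilon> f1 f2 f3
      assume e: "thin_annulus \<epsilon>" and f: "unit_norm (u * a1 + v * b1) f1" "unit_norm (u * a2 + v * b2) f2"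
        "unit_norm (u * a3 + v * b3) f3"
      interpret thin_annulus \<epsilon> by fact
      obtain g1 h1 where 1: "unit_norm a1 g1" "unit_norm b1 h1" "\<And>x. f1 x = g1 x powr u * h1 x powr v"
        using unit_norm_interpolate[OF f(1) a(1) b(1) uv] by blast
      obtain g2 h2 where 2: "unit_norm a2 g2" "unit_norm b2 h2" "\<And>x. f2 x = g2 x powr u * h2 x powr v"
        using unit_norm_interpolate[OF f(2) a(2) b(2) uv] by blast
      obtain g3 h3 where 3: "unit_norm a3 g3" "unit_norm b3 h3" "\<And>x. f3 x = g3 x powr u * h3 x powr v"
        using unit_norm_interpolate[OF f(3) a(3) b(3) uv] by blast
      note [measurable] = 1(1,2)[THEN unit_normD(1)] 2(1,2)[THEN unit_normD(1)] 3(1,2)[THEN unit_normD(1)]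
      note nn = 1(1,2)[THEN unit_normD(2)] 2(1,2)[THEN unit_normD(2)] 3(1,2)[THEN unit_normD(2)]
      define S where "S x y z = sigma_eps \<epsilon> (x - y) * sigma_eps \<epsilon> (x - z) * sigma_eps \<epsilon> (y - z)" for x y z
      have [measurable]: "(\<lambda>x. S (f x) (g x) (h x)) \<in> borel_measurable M"
        if [measurable]: "f \<in> borel_measurable M" "g \<in> borel_measurable M" "h \<in> borel_measurable M"
        for f g h and M :: "'b measure"
        unfolding S_def by measurable
      have "Lambda_eps \<epsilon> f1 f2 f3 \<le> (\<integral>\<^sup>+x. \<integral>\<^sup>+y. \<integral>\<^sup>+z.
          S x y z * ennreal (g1 x) * ennreal (g2 y) * ennreal (g3 z)
          + S x y z * ennreal (h1 x) * ennreal (h2 y) * ennreal (h3 z) \<partial>lborel \<partial>lborel \<partial>lborel)"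
        unfolding Lambda_eps_eq_Lam Lam_def S_def[symmetric]
      proof (intro nn_integral_mono)
        fix x y z
        have "f1 x * f2 y * f3 z = (g1 x * g2 y * g3 z) powr u * (h1 x * h2 y * h3 z) powr v"
          unfolding 1(3) 2(3) 3(3) using nn by (simp add: powr_mult mult_ac)
        also have "\<dots> \<le> g1 x * g2 y * g3 z + h1 x * h2 y * h3 z"
          using nn uv by (intro powr_mult_powr_le_add) auto
        finally have "ennreal (f1 x * f2 y * f3 z) \<le> ennreal (g1 x * g2 y * g3 z + h1 x * h2 y * h3 z)"
          by (rule ennreal_leI)
        then have "S x y z * ennreal (f1 x * f2 y * f3 z) \<le> S x y z * ennreal (g1 x * g2 y * g3 z + h1 x * h2 y * h3 z)"
          by (rule mult_left_mono) simp
        then show "S x y z * ennreal (f1 x) * ennreal (f2 y) * ennreal (f3 z)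
          \<le> S x y z * ennreal (g1 x) * ennreal (g2 y) * ennreal (g3 z)
          + S x y z * ennreal (h1 x) * ennreal (h2 y) * ennreal (h3 z)"
          using nn f[THEN unit_normD(2)] by (simp add: ennreal_mult distrib_left mult.assoc)
      qed
      also have "\<dots> = Lambda_eps \<epsilon> g1 g2 g3 + Lambda_eps \<epsilon> h1 h2 h3"
        unfolding Lambda_eps_eq_Lam Lam_def S_def[symmetric] by (simp add: nn_integral_add)
      also have "\<dots> \<le> ennreal C + ennreal D"
        using 1 2 3 e by (intro add_mono C D)
      finally show "Lambda_eps \<epsilon> f1 f2 f3 \<le> ennreal (C + D)" using a b by simp
    qed (use a b uv in auto)
    then show ?thesis by (simp add: pq)
  qed
qed

lemma triangle_polytope_subset_bounded_exponents: "triangle_polytope \<subseteq> bounded_exponents"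
  unfolding triangle_polytope_def
proof (rule hull_minimal)
  note 1 = bounded_exponents_one_zero_zero
  note 2 = bounded_exponents_swap12[OF 1]
  note 3 = bounded_exponents_swap23[OF 2]
  note 4 = bounded_exponents_two_thirds
  note 5 = bounded_exponents_swap23[OF 4]
  note 6 = bounded_exponents_swap12[OF 5]
  show "{(1, 0, 0), (0, 1, 0), (0, 0, 1), (2/3, 2/3, 0), (2/3, 0, 2/3), (0, 2/3, 2/3), (1/2, 1/2, 1/2)}
      \<subseteq> bounded_exponents"
    using 1 2 3 4 5 6 bounded_exponents_half by simp
qed (rule convex_bounded_exponents)

section \<open>From normalized Borel functions to arbitrary nonnegative measurable functions\<close>

text \<open>A Lebesgue measurable function agrees almost everywhere with a Borel one, which is then
  divided by the norm; for norm 0 the function vanishes almost everywhere and \<open>g = 0\<close>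
  is taken.\<close>

lemma Lp_norm_normalize:
  assumes f: "nonneg_meas f" and t: "0 \<le> t" and c: "Lp_norm t f = ennreal c" "0 \<le> c"
  obtains g where "unit_norm t g" "AE x in lborel. f x = c * g x"
proof -
  have f0: "0 \<le> f x" for x using f by (simp add: nonneg_meas_def)
  have [measurable]: "f \<in> borel_measurable lebesgue" using f by (simp add: nonneg_meas_def)
  obtain f' where [measurable]: "f' \<in> borel_measurable borel" and f': "AE x in lborel. f x = f' x"
    using completion_ex_borel_measurable_real[of f lborel] by auto
  have f0': "AE x in lborel. 0 \<le> f x" using f0 by simp
  note result = that
  have AE_zero: thesis if "c = 0" "AE x in lborel. f x = 0"
    using that by (intro result[of "\<lambda>x. 0"]) (auto simp: unit_norm_def)
  show thesis
  proof (cases "t = 0")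
    case True
    have "AE x in lebesgue. ennreal (f x) \<le> ennreal c"
      using esssup_AE[of "\<lambda>x. ennreal (f x)" lebesgue] c True by (simp add: Lp_norm_def)
    then have le: "AE x in lborel. f x \<le> c"
      using c by (simp add: AE_completion_iff ennreal_le_iff)
    show thesis
    proof (cases "c = 0")
      case T: True
      then show thesis using le f0 by (intro AE_zero) (auto intro: antisym)
    next
      case False
      then have c0: "c > 0" using c by simp
      show thesis
      proof (rule that)
        \<comment> \<open>Clipping to \<open>[0, 1]\<close> changes the quotient only on a null set
          and makes the bounds hold at every point.\<close>
        show "unit_norm t (\<lambda>x. min 1 (max 0 (f' x / c)))"
          unfolding unit_norm_def using True by auto
        show "AE x in lborel. f x = c * min 1 (max 0 (f' x / c))"
          using le f' f0' by eventually_elim (use c0 in \<open>auto simp: min_def max_def field_simps not_le\<close>)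
      qed
    qed
  next
    case False
    then have t0: "t > 0" using t by simp
    define I where "I = (\<integral>\<^sup>+x. ennreal (f x powr (1 / t)) \<partial>lborel)"
    have N: "Lp_norm t f = enn_powr I t"
      using False by (simp add: Lp_norm_def I_def nn_integral_completion)
    have Ifin: "I \<noteq> \<infinity>" using c by (auto simp: N enn_powr_def)
    then obtain i where i: "I = ennreal i" "0 \<le> i" by (cases I) auto
    have ci: "c = i powr t"
      using c i by (simp add: N enn_powr_def)
    have I': "I = (\<integral>\<^sup>+x. ennreal (max 0 (f' x) powr (1 / t)) \<partial>lborel)"
      unfolding I_def
    proof (rule nn_integral_cong_AE)
      show "AE x in lborel. ennreal (f x powr (1 / t)) = ennreal (max 0 (f' x) powr (1 / t))"
        using f' f0' by eventually_elim (simp add: max_absorb2)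
    qed
    show thesis
    proof (cases "c = 0")
      case True
      then have "I = 0" using ci i by simp
      then have "AE x in lborel. ennreal (max 0 (f' x) powr (1 / t)) = 0"
        unfolding I' by (subst (asm) nn_integral_0_iff_AE) auto
      then have "AE x in lborel. f x = 0"
        using f' f0' by eventually_elim (auto simp: max_absorb2 ennreal_eq_0_iff dest: leD)
      with True show thesis by (intro AE_zero)
    next
      case False
      then have c0: "c > 0" "i > 0" using c ci i by (auto simp: less_le)
      show thesis
      proof (rule that)
        have cp: "c powr (1 / t) = i" using c0 t0 by (simp add: ci powr_powr)
        have "(\<integral>\<^sup>+x. ennreal ((max 0 (f' x) / c) powr (1 / t)) \<partial>lborel)
            = (\<integral>\<^sup>+x. ennreal (1 / i) * ennreal (max 0 (f' x) powr (1 / t)) \<partial>lborel)"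
          using c0 by (intro nn_integral_cong) (simp add: powr_divide cp ennreal_mult[symmetric])
        also have "\<dots> = ennreal (1 / i) * I" unfolding I' by (rule nn_integral_cmult) measurable
        also have "\<dots> = 1" using c0 by (simp add: i ennreal_mult[symmetric])
        finally show "unit_norm t (\<lambda>x. max 0 (f' x) / c)"
          unfolding unit_norm_def using t0 c0 by auto
        show "AE x in lborel. f x = c * (max 0 (f' x) / c)"
          using f' f0' by eventually_elim (use c0 in \<open>auto simp: max_def\<close>)
      qed
    qed
  qed
qed

text \<open>Each function depends on a single integration variable, so it is exchanged inside the
  integral over that variable while the remaining factors stay arbitrary.\<close>

lemma Lambda_eps_AE_cong:
  assumes "AE x in lborel. f1 x = g1 x" "AE x in lborel. f2 x = g2 x" "AE x in lborel. f3 x = g3 x"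
  shows "Lambda_eps \<epsilon> f1 f2 f3 = Lambda_eps \<epsilon> g1 g2 g3"
proof -
  have 3: "(\<integral>\<^sup>+z. S z * ennreal (f3 z) \<partial>lborel) = (\<integral>\<^sup>+z. S z * ennreal (g3 z) \<partial>lborel)" for S
    using assms(3) by (intro nn_integral_cong_AE) (auto elim: eventually_mono)
  have 2: "(\<integral>\<^sup>+y. \<integral>\<^sup>+z. S y z * ennreal (f2 y) * T z \<partial>lborel \<partial>lborel)
      = (\<integral>\<^sup>+y. \<integral>\<^sup>+z. S y z * ennreal (g2 y) * T z \<partial>lborel \<partial>lborel)" for S T
    using assms(2) by (intro nn_integral_cong_AE) (auto elim: eventually_mono)
  have 1: "(\<integral>\<^sup>+x. \<integral>\<^sup>+y. \<integral>\<^sup>+z. S x y z * ennreal (f1 x) * T y * U z \<partial>lborel \<partial>lborel \<partial>lborel)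
      = (\<integral>\<^sup>+x. \<integral>\<^sup>+y. \<integral>\<^sup>+z. S x y z * ennreal (g1 x) * T y * U z \<partial>lborel \<partial>lborel \<partial>lborel)" for S T U
    using assms(1) by (intro nn_integral_cong_AE) (auto elim: eventually_mono)
  show ?thesis unfolding Lambda_eps_def nn_integral_completion 3 2 1 ..
qed

lemma (in thin_annulus) Lambda_eps_scale:
  assumes [measurable]: "g1 \<in> borel_measurable borel" "g2 \<in> borel_measurable borel" "g3 \<in> borel_measurable borel"
    and c: "0 \<le> c1" "0 \<le> c2" "0 \<le> c3"
  shows "Lambda_eps \<epsilon> (\<lambda>x. c1 * g1 x) (\<lambda>x. c2 * g2 x) (\<lambda>x. c3 * g3 x)
    = ennreal c1 * ennreal c2 * ennreal c3 * Lambda_eps \<epsilon> g1 g2 g3"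
proof -
  have "Lambda_eps \<epsilon> (\<lambda>x. c1 * g1 x) (\<lambda>x. c2 * g2 x) (\<lambda>x. c3 * g3 x)
    = (\<integral>\<^sup>+x. \<integral>\<^sup>+y. \<integral>\<^sup>+z. (ennreal c1 * ennreal c2 * ennreal c3) * (\<sigma> (x - y) * \<sigma> (x - z) * \<sigma> (y - z)
      * ennreal (g1 x) * ennreal (g2 y) * ennreal (g3 z)) \<partial>lborel \<partial>lborel \<partial>lborel)"
    unfolding Lambda_eps_eq_Lam Lam_def using c by (simp add: ennreal_mult' mult_ac)
  also have "\<dots> = ennreal c1 * ennreal c2 * ennreal c3 * Lambda_eps \<epsilon> g1 g2 g3"
    unfolding Lambda_eps_eq_Lam Lam_def by (simp add: nn_integral_cmult)
  finally show ?thesis .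
qed

lemma nonneg_meas_AE_zero:
  assumes "nonneg_meas f" "0 \<le> t" "Lp_norm t f = 0"
  shows "AE x in lborel. f x = 0"
  using Lp_norm_normalize[of f t 0] assms by auto

lemma eventually_thin_annulus: "\<forall>\<^sub>F \<epsilon> in at_right 0. thin_annulus \<epsilon>"
  by (rule eventually_at_rightI[of 0 "1/20"]) (auto simp: thin_annulus_def)

lemma Lambda_sup_le_of_bounded_exponents:
  assumes "(t1, t2, t3) \<in> bounded_exponents"
  shows "\<exists>C::real. \<forall>f1 f2 f3. nonneg_meas f1 \<and> nonneg_meas f2 \<and> nonneg_meas f3 \<longrightarrow>
    Lambda_sup f1 f2 f3 \<le> ennreal C * Lp_norm t1 f1 * Lp_norm t2 f2 * Lp_norm t3 f3"
proof -
  obtain C where t: "0 \<le> t1" "0 \<le> t2" "0 \<le> t3" and C1: "1 \<le> C"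
    and C: "\<And>\<epsilon> f g h. thin_annulus \<epsilon> \<Longrightarrow> unit_norm t1 f \<Longrightarrow> unit_norm t2 g \<Longrightarrow> unit_norm t3 h
      \<Longrightarrow> Lambda_eps \<epsilon> f g h \<le> ennreal C"
    using assms by (elim bounded_exponentsE) (rule that)
  have main: "Lambda_eps \<epsilon> f1 f2 f3 \<le> ennreal C * Lp_norm t1 f1 * Lp_norm t2 f2 * Lp_norm t3 f3"
    if e: "thin_annulus \<epsilon>" and f: "nonneg_meas f1" "nonneg_meas f2" "nonneg_meas f3" for f1 f2 f3 \<epsilon>
  proof -
    \<comment> \<open>Norm 0 is treated apart because \<open>0 * \<infinity> = 0\<close> in
      \<open>ennreal\<close>: even if another norm is infinite, the form itself must be shown to
      vanish.\<close>
    consider "Lp_norm t1 f1 = 0 \<or> Lp_norm t2 f2 = 0 \<or> Lp_norm t3 f3 = 0"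
      | "Lp_norm t1 f1 \<noteq> 0" "Lp_norm t2 f2 \<noteq> 0" "Lp_norm t3 f3 \<noteq> 0"
        "Lp_norm t1 f1 = \<infinity> \<or> Lp_norm t2 f2 = \<infinity> \<or> Lp_norm t3 f3 = \<infinity>"
      | "Lp_norm t1 f1 \<noteq> \<infinity>" "Lp_norm t2 f2 \<noteq> \<infinity>" "Lp_norm t3 f3 \<noteq> \<infinity>" by blast
    then show ?thesis
    proof cases
      case 1
      then have "(AE x in lborel. f1 x = 0) \<or> (AE x in lborel. f2 x = 0) \<or> (AE x in lborel. f3 x = 0)"
        using nonneg_meas_AE_zero f t by blast
      then have "Lambda_eps \<epsilon> f1 f2 f3 = 0"
        using Lambda_eps_AE_cong[of f1 "\<lambda>x. 0" f2 f2 f3 f3] Lambda_eps_AE_cong[of f1 f1 f2 "\<lambda>x. 0" f3 f3]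
          Lambda_eps_AE_cong[of f1 f1 f2 f2 f3 "\<lambda>x. 0"]
        by (auto simp: Lambda_eps_def)
      then show ?thesis by simp
    next
      case 2
      then have "ennreal C * Lp_norm t1 f1 * Lp_norm t2 f2 * Lp_norm t3 f3 = \<infinity>"
        using C1 by (auto simp: ennreal_mult_eq_top_iff)
      then show ?thesis by simp
    next
      case 3
      then obtain c1 c2 c3 where c: "Lp_norm t1 f1 = ennreal c1" "Lp_norm t2 f2 = ennreal c2"
          "Lp_norm t3 f3 = ennreal c3" "0 \<le> c1" "0 \<le> c2" "0 \<le> c3"
        by (metis ennreal_cases infinity_ennreal_def)
      obtain g1 where 1: "unit_norm t1 g1" "AE x in lborel. f1 x = c1 * g1 x"
        using Lp_norm_normalize f t c by blast
      obtain g2 where 2: "unit_norm t2 g2" "AE x in lborel. f2 x = c2 * g2 x"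
        using Lp_norm_normalize f t c by blast
      obtain g3 where 3: "unit_norm t3 g3" "AE x in lborel. f3 x = c3 * g3 x"
        using Lp_norm_normalize f t c by blast
      have "Lambda_eps \<epsilon> f1 f2 f3 = Lambda_eps \<epsilon> (\<lambda>x. c1 * g1 x) (\<lambda>x. c2 * g2 x) (\<lambda>x. c3 * g3 x)"
        using 1 2 3 by (intro Lambda_eps_AE_cong)
      also have "\<dots> = ennreal c1 * ennreal c2 * ennreal c3 * Lambda_eps \<epsilon> g1 g2 g3"
        using 1 2 3 c by (intro thin_annulus.Lambda_eps_scale[OF e] unit_normD(1))
      also have "\<dots> \<le> ennreal c1 * ennreal c2 * ennreal c3 * ennreal C"
        using 1 2 3 e by (intro mult_left_mono C) auto
      finally show ?thesis unfolding c(1-3) by (simp add: mult_ac)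
    qed
  qed
  show ?thesis
    unfolding Lambda_sup_def
    by (rule exI[of _ C]) (auto intro!: Limsup_bounded eventually_mono[OF eventually_thin_annulus] main)
qed

section \<open>Necessity\<close>

context thin_annulus
begin

text \<open>For \<open>x\<close> in the annulus of half-width \<open>\<epsilon> / 2\<close> around
  \<open>z\<close>, the third vertex \<open>c\<close> of an equilateral triangle on \<open>z\<close>
  and \<open>x\<close> is the centre of a disc of radius \<open>\<epsilon> / 2\<close> on which the
  kernel is positive. Area of disc times area of annulus times the three factors
  \<open>1 / (2 * \<epsilon>)\<close> is \<open>pi * pi / 16\<close>.\<close>

lemma nn_integral_K_ge:
  "ennreal (1/2) \<le> (\<integral>\<^sup>+x. \<integral>\<^sup>+y. K z x y \<partial>lborel \<partial>lborel)"
proof -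
  \<comment> \<open>Cosine and sine of 60 degrees, kept as unknowns with two polynomial relations,
    so that the isometry identities are purely algebraic.\<close>
  have "\<exists>h k :: real. h * h + k * k = 1 \<and> 2 * h = 1"
    by (rule exI[of _ "1/2"], rule exI[of _ "sqrt 3 / 2"]) simp
  then obtain h k :: real where hk: "h * h + k * k = 1" "2 * h = 1" by blast
  define rot where "rot v = (vector [h * v$1 - k * v$2, k * v$1 + h * v$2] :: real^2)" for v :: "real^2"
  have "rot v \<bullet> rot v = v \<bullet> v" for v
    using hk unfolding rot_def inner_vec2 vector_2 by algebra
  then have rot1: "norm (rot v) = norm v" for v by (simp add: norm_eq_sqrt_inner)
  have "(rot v - v) \<bullet> (rot v - v) = v \<bullet> v" for v
    using hk unfolding rot_def inner_vec2 vector_2 vector_minus_component by algebra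
  then have rot2: "norm (rot v - v) = norm v" for v by (simp add: norm_eq_sqrt_inner)
  define A where "A = {x. \<bar>norm (x - z) - 1\<bar> \<le> \<epsilon> / 2}"
  have inner: "ennreal (pi / (32 * \<epsilon>)) * indicator A x \<le> (\<integral>\<^sup>+y. K z x y \<partial>lborel)" for x
  proof (cases "x \<in> A")
    case True
    define c where "c = z + rot (x - z)"
    have "ennreal (1 / (2 * \<epsilon>) * (1 / (2 * \<epsilon>)) * (1 / (2 * \<epsilon>))) * indicator (cball c (\<epsilon> / 2)) y \<le> K z x y" for y
    proof (cases "y \<in> cball c (\<epsilon> / 2)")
      case y: True
      have n1: "norm (c - z) = norm (x - z)" by (simp add: c_def rot1)
      have "c - x = rot (x - z) - (x - z)" by (simp add: c_def)
      then have n2: "norm (c - x) = norm (x - z)" by (simp only: rot2)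
      have yc: "norm (y - c) \<le> \<epsilon> / 2" using y by (simp add: dist_norm norm_minus_commute)
      have tri: "\<bar>norm (y - w) - norm (c - w)\<bar> \<le> norm (y - c)" for w
        using norm_triangle_ineq3[of "y - w" "c - w"] by simp
      have "\<bar>norm (x - z) - 1\<bar> \<le> \<epsilon>" "\<bar>norm (y - x) - 1\<bar> \<le> \<epsilon>" "\<bar>norm (y - z) - 1\<bar> \<le> \<epsilon>"
        using True tri[of x] tri[of z] yc n1 n2 eps_pos unfolding A_def mem_Collect_eq by linarith+
      then show ?thesis
        using eps_pos by (simp add: K_def sigma_eps_def ennreal_mult[symmetric] indicator_def)
    qed simp
    then have "(\<integral>\<^sup>+y. ennreal (1 / (2 * \<epsilon>) * (1 / (2 * \<epsilon>)) * (1 / (2 * \<epsilon>))) * indicator (cball c (\<epsilon> / 2)) y \<partial>lborel)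
      \<le> (\<integral>\<^sup>+y. K z x y \<partial>lborel)"
      by (intro nn_integral_mono)
    also have "(\<integral>\<^sup>+y. ennreal (1 / (2 * \<epsilon>) * (1 / (2 * \<epsilon>)) * (1 / (2 * \<epsilon>))) * indicator (cball c (\<epsilon> / 2)) y \<partial>lborel)
      = ennreal (1 / (2 * \<epsilon>) * (1 / (2 * \<epsilon>)) * (1 / (2 * \<epsilon>))) * ennreal (pi * (\<epsilon> / 2)\<^sup>2)"
      using eps_pos by (subst nn_integral_cmult_indicator) (auto simp: emeasure_cball unit_ball_vol_2)
    also have "\<dots> = ennreal (pi / (32 * \<epsilon>))"
      using eps_pos by (subst ennreal_mult[symmetric]) (auto simp: power2_eq_square field_simps)
    finally show ?thesis using True by simp
  qed simp
  have [measurable]: "A \<in> sets borel" unfolding A_def by measurable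
  have "ennreal (1/2) \<le> ennreal (pi / (32 * \<epsilon>) * (4 * pi * (\<epsilon> / 2)))"
  proof (rule ennreal_leI)
    have "3 * 3 \<le> pi * pi" using pi_gt3 by (intro mult_mono) auto
    moreover have "pi / (32 * \<epsilon>) * (4 * pi * (\<epsilon> / 2)) = pi * pi / 16" using eps_pos by (simp add: field_simps)
    ultimately show "1/2 \<le> pi / (32 * \<epsilon>) * (4 * pi * (\<epsilon> / 2))" by simp
  qed
  also have "\<dots> = ennreal (pi / (32 * \<epsilon>)) * emeasure lborel A"
  proof -
    have "emeasure lborel A = ennreal (4 * pi * (\<epsilon> / 2))"
      unfolding A_def using eps_pos eps_le by (intro emeasure_annulus) auto
    then show ?thesis using eps_pos by (simp only: ennreal_mult[symmetric]) (subst ennreal_mult[symmetric], auto)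
  qed
  also have "\<dots> = (\<integral>\<^sup>+x. ennreal (pi / (32 * \<epsilon>)) * indicator A x \<partial>lborel)"
    by (subst nn_integral_cmult_indicator) auto
  also have "\<dots> \<le> (\<integral>\<^sup>+x. \<integral>\<^sup>+y. K z x y \<partial>lborel \<partial>lborel)" by (intro nn_integral_mono inner)
  finally show ?thesis .
qed

text \<open>For \<open>z\<close> in the ball, both other vertices lie within
  \<open>\<epsilon> + r \<le> 2 * r\<close> of the unit circle. So \<open>E\<close> contains the
  whole support of the kernel, and the form is at least half the area of the ball, independently of
  \<epsilon>.\<close>

lemma Lambda_eps_annulus_ball_ge:
  assumes r: "\<epsilon> \<le> r"
  defines "E \<equiv> {y::real^2. \<bar>norm y - 1\<bar> \<le> 2 * r}"
  shows "ennreal (pi * r\<^sup>2 / 2) \<le> Lambda_eps \<epsilon> (indicator E) (indicator E) (indicator (ball 0 r))"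
proof -
  have r0: "0 < r" using eps_pos r by simp
  have [measurable]: "E \<in> sets borel" unfolding E_def by measurable
  have [measurable]: "ball (0::real^2) r \<in> sets borel" by simp
  have "ennreal (pi * r\<^sup>2 / 2) = ennreal (1/2 * (pi * r\<^sup>2))" by simp
  also have "\<dots> = ennreal (1/2) * ennreal (pi * r\<^sup>2)" by (subst ennreal_mult) auto
  also have "\<dots> = ennreal (1/2) * emeasure lborel (ball (0::real^2) r)"
    using r0 by (simp only: emeasure_ball) (simp add: unit_ball_vol_2)
  also have "\<dots> = (\<integral>\<^sup>+z. ennreal (1/2) * indicator (ball (0::real^2) r) z \<partial>lborel)"
    by (subst nn_integral_cmult_indicator) auto
  also have "\<dots> \<le> (\<integral>\<^sup>+z. ennreal (indicator (ball 0 r) z) *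
      (\<integral>\<^sup>+x. \<integral>\<^sup>+y. K z x y * ennreal (indicator E x) * ennreal (indicator E y) \<partial>lborel \<partial>lborel) \<partial>lborel)"
  proof (rule nn_integral_mono)
    fix z :: "real^2"
    show "ennreal (1/2) * indicator (ball 0 r) z \<le> ennreal (indicator (ball 0 r) z) *
      (\<integral>\<^sup>+x. \<integral>\<^sup>+y. K z x y * ennreal (indicator E x) * ennreal (indicator E y) \<partial>lborel \<partial>lborel)"
    proof (cases "z \<in> ball 0 r")
      case True
      have inE: "w \<in> E" if "\<sigma> (w - z) \<noteq> 0" for w
      proof -
        have "\<bar>norm (w - z) - 1\<bar> \<le> \<epsilon>" using that by (auto simp: sigma_eps_def split: if_splits)
        moreover have "\<bar>norm w - norm (w - z)\<bar> \<le> norm z"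
          using norm_triangle_ineq3[of w "w - z"] by simp
        ultimately show ?thesis using True r by (auto simp: E_def)
      qed
      have "K z x y = K z x y * ennreal (indicator E x) * ennreal (indicator E y)" for x y
        using inE[of x] inE[of y] by (cases "K z x y = 0") (auto simp: K_def)
      then show ?thesis using nn_integral_K_ge[of z] True by simp
    qed simp
  qed
  also have "\<dots> = Lambda_eps \<epsilon> (indicator E) (indicator E) (indicator (ball 0 r))"
    unfolding Lambda_eps_eq_Lam by (subst Lam_eq_K, measurable)
  finally show ?thesis .
qed

end

lemma Lp_norm_indicator_le:
  assumes [measurable]: "A \<in> sets borel" and A: "emeasure lborel A \<le> ennreal m" and m: "0 < m" and t: "0 \<le> t"
  shows "Lp_norm t (indicator A) \<le> ennreal (m powr t)"
proof (cases "t = 0")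
  case True
  have "esssup lebesgue (\<lambda>x. ennreal (indicator A x)) \<le> 1"
    by (rule esssup_I) (auto simp: indicator_def intro!: measurable_completion)
  then show ?thesis using True m by (simp add: Lp_norm_def)
next
  case False
  have "(indicator A x :: real) powr (1 / t) = indicator A x" for x by (simp add: indicator_def)
  then have N: "Lp_norm t (indicator A) = enn_powr (emeasure lborel A) t"
    using False by (simp add: Lp_norm_def nn_integral_completion ennreal_indicator)
  obtain a where a: "emeasure lborel A = ennreal a" "0 \<le> a" "a \<le> m"
    using A m by (cases "emeasure lborel A") (auto simp: top_unique)
  then show ?thesis using t by (auto simp: N enn_powr_def intro!: ennreal_leI powr_mono2)
qed

text \<open>The consequence of a bound that is tested. It concerns Borel sets, where the form is
  symmetric in its arguments, so that one family of test sets serves all permutations of the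
  exponents.\<close>

definition indicator_bounded :: "real \<Rightarrow> real \<Rightarrow> real \<Rightarrow> bool" where
  "indicator_bounded a b c \<longleftrightarrow> (\<exists>C::real. \<forall>E F G. E \<in> sets borel \<and> F \<in> sets borel \<and> G \<in> sets borel \<longrightarrow>
     Lambda_inf (indicator E) (indicator F) (indicator G)
       \<le> ennreal C * Lp_norm a (indicator E) * Lp_norm b (indicator F) * Lp_norm c (indicator G))"

lemma indicator_bounded_swap12: 
  assumes "indicator_bounded a b c"
  shows "indicator_bounded b a c"
proof -
  obtain C where C: "\<And>E F G. E \<in> sets borel \<Longrightarrow> F \<in> sets borel \<Longrightarrow> G \<in> sets borel \<Longrightarrow>
     Lambda_inf (indicator E) (indicator F) (indicator G)
       \<le> ennreal C * Lp_norm a (indicator E) * Lp_norm b (indicator F) * Lp_norm c (indicator G)"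
    using assms unfolding indicator_bounded_def by blast
  have "Lambda_inf (indicator E) (indicator F) (indicator G) = Lambda_inf (indicator F) (indicator E) (indicator G)"
    if "E \<in> sets borel" "F \<in> sets borel" "G \<in> sets borel" for E F G
    unfolding Lambda_inf_def
    by (rule Liminf_eq, rule eventually_mono[OF eventually_thin_annulus])
       (use that in \<open>auto intro: thin_annulus.Lambda_eps_swap12\<close>)
  note swap = this
  show ?thesis
    unfolding indicator_bounded_def
  proof (intro exI[of _ C] allI impI, elim conjE)
    fix E F G :: "(real^2) set"
    assume m: "E \<in> sets borel" "F \<in> sets borel" "G \<in> sets borel"
    show "Lambda_inf (indicator E) (indicator F) (indicator G)
       \<le> ennreal C * Lp_norm b (indicator E) * Lp_norm a (indicator F) * Lp_norm c (indicator G)"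
      using C[of F E G] m unfolding swap[OF m] by (simp add: mult_ac)
  qed
qed

lemma indicator_bounded_swap23: 
  assumes "indicator_bounded a b c"
  shows "indicator_bounded a c b"
proof -
  obtain C where C: "\<And>E F G. E \<in> sets borel \<Longrightarrow> F \<in> sets borel \<Longrightarrow> G \<in> sets borel \<Longrightarrow>
     Lambda_inf (indicator E) (indicator F) (indicator G)
       \<le> ennreal C * Lp_norm a (indicator E) * Lp_norm b (indicator F) * Lp_norm c (indicator G)"
    using assms unfolding indicator_bounded_def by blast
  have "Lambda_inf (indicator E) (indicator F) (indicator G) = Lambda_inf (indicator E) (indicator G) (indicator F)"
    if "E \<in> sets borel" "F \<in> sets borel" "G \<in> sets borel" for E F G
    unfolding Lambda_inf_def
    by (rule Liminf_eq, rule eventually_mono[OF eventually_thin_annulus])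
       (use that in \<open>auto intro: thin_annulus.Lambda_eps_swap23\<close>)
  note swap = this
  show ?thesis
    unfolding indicator_bounded_def
  proof (intro exI[of _ C] allI impI, elim conjE)
    fix E F G :: "(real^2) set"
    assume m: "E \<in> sets borel" "F \<in> sets borel" "G \<in> sets borel"
    show "Lambda_inf (indicator E) (indicator F) (indicator G)
       \<le> ennreal C * Lp_norm a (indicator E) * Lp_norm c (indicator F) * Lp_norm b (indicator G)"
      using C[of E G F] m unfolding swap[OF m] by (simp add: mult_ac)
  qed
qed

text \<open>Otherwise dividing by \<open>r powr a\<close> and letting \<open>r\<close> tend to 0
  gives a contradiction. The range \<open>r \<le> 1/2\<close> is the one in which the area formula
  for the annulus of half-width \<open>2 * r\<close> applies.\<close>

lemma powr_le_imp_exponent_le: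
  fixes a b M :: real
  assumes "\<And>r. 0 < r \<Longrightarrow> r \<le> 1/2 \<Longrightarrow> r powr a \<le> M * r powr b"
  shows "b \<le> a"
proof (rule ccontr)
  assume "\<not> b \<le> a"
  then have d: "0 < b - a" by simp
  define N where "N = max M 1 + 1"
  define r where "r = min (1/2) (N powr (- (1 / (b - a))))"
  have N: "1 < N" "M < N" by (auto simp: N_def)
  have r: "0 < r" "r \<le> 1/2" using N by (auto simp: r_def)
  have "r powr (b - a) \<le> (N powr (- (1 / (b - a)))) powr (b - a)"
    using d r by (intro powr_mono2) (auto simp: r_def)
  also have "\<dots> = N powr (- (1 / (b - a)) * (b - a))" by (rule powr_powr)
  also have "- (1 / (b - a)) * (b - a) = -1" using d by simp
  also have "N powr (-1) = 1 / N" using N by (simp add: powr_minus_divide)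
  finally have le: "r powr (b - a) \<le> 1 / N" .
  have "r powr a \<le> M * r powr (b - a) * r powr a"
    using assms[OF r] by (simp add: powr_add[symmetric] mult.assoc)
  then have "1 \<le> M * r powr (b - a)" using r by simp
  moreover have "M * r powr (b - a) \<le> max M 1 * (1 / N)"
    using le by (intro mult_mono) auto
  moreover have "max M 1 * (1 / N) < 1" using N by (simp add: N_def)
  ultimately show False by linarith
qed

text \<open>The form is of size at least \<open>r^2\<close> and the ball has area of order
  \<open>r^2\<close>. The annulus has area of order \<open>r\<close> for small \<open>r\<close> and
  \<open>r^2\<close> for large \<open>r\<close>; comparing powers of \<open>r\<close> in the two
  regimes gives the two inequalities.\<close>

lemma indicator_bounded_necessary:
  assumes "indicator_bounded t1 t2 t3" and t: "0 \<le> t1" "0 \<le> t2" "0 \<le> t3"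
  shows "1 \<le> t1 + t2 + t3" "t3 + (t1 + t2 + t3) \<le> 2"
proof -
  obtain C' where C': "\<And>E F G. E \<in> sets borel \<Longrightarrow> F \<in> sets borel \<Longrightarrow> G \<in> sets borel \<Longrightarrow>
     Lambda_inf (indicator E) (indicator F) (indicator G)
       \<le> ennreal C' * Lp_norm t1 (indicator E) * Lp_norm t2 (indicator F) * Lp_norm t3 (indicator G)"
    using assms unfolding indicator_bounded_def by blast
  \<comment> \<open>\<open>ennreal\<close> sends negative reals to 0, so replacing a negative
    constant by 0 leaves the bound unchanged.\<close>
  define C where "C = max 0 C'"
  have C0: "0 \<le> C" and eC: "ennreal C' = ennreal C"
    by (auto simp: C_def ennreal_neg max_def)
  define E where "E r = {y::real^2. \<bar>norm y - 1\<bar> \<le> 2 * r}" for r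
  have [measurable]: "E r \<in> sets borel" for r unfolding E_def by measurable
  have key: "pi * r\<^sup>2 / 2 \<le> C * m powr t1 * m powr t2 * (pi * r\<^sup>2) powr t3"
    if r: "0 < r" and m: "0 < m" "emeasure lborel (E r) \<le> ennreal m" for r m
  proof -
    have "\<forall>\<^sub>F \<epsilon> in at_right 0. thin_annulus \<epsilon> \<and> \<epsilon> \<le> r"
      using r by (intro eventually_conj eventually_thin_annulus eventually_at_rightI[of 0 r]) auto
    then have "ennreal (pi * r\<^sup>2 / 2) \<le> Lambda_inf (indicator (E r)) (indicator (E r)) (indicator (ball 0 r))"
      unfolding Lambda_inf_def
      by (intro Liminf_bounded) (auto elim!: eventually_mono simp: E_def intro: thin_annulus.Lambda_eps_annulus_ball_ge)
    also have "\<dots> \<le> ennreal C * Lp_norm t1 (indicator (E r)) * Lp_norm t2 (indicator (E r)) * Lp_norm t3 (indicator (ball 0 r))"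
      unfolding eC[symmetric] by (rule C') auto
    also have "\<dots> \<le> ennreal C * ennreal (m powr t1) * ennreal (m powr t2) * ennreal ((pi * r\<^sup>2) powr t3)"
      using r m t by (intro mult_mono order_refl Lp_norm_indicator_le) (auto simp: emeasure_ball unit_ball_vol_2)
    also have "\<dots> = ennreal (C * m powr t1 * m powr t2 * (pi * r\<^sup>2) powr t3)"
      using C0 by (simp add: ennreal_mult)
    finally show ?thesis using C0 by (simp add: ennreal_le_iff)
  qed
  show "t3 + (t1 + t2 + t3) \<le> 2"
  proof (rule powr_le_imp_exponent_le)
    fix r :: real assume r: "0 < r" "r \<le> 1/2"
    have e: "r powr (t3 + (t1 + t2 + t3)) = r powr t3 * (r powr t1 * r powr t2 * r powr t3)"
      by (simp only: powr_add)
    have "pi * r\<^sup>2 / 2 \<le> C * (8 * pi * r) powr t1 * (8 * pi * r) powr t2 * (pi * r\<^sup>2) powr t3"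
      using r emeasure_annulus[of "2 * r" 0] by (intro key) (auto simp: E_def)
    also have "\<dots> = C * (8 * pi) powr t1 * (8 * pi) powr t2 * pi powr t3 * r powr (t3 + (t1 + t2 + t3))"
      unfolding e using r by (simp add: powr_mult power2_eq_square)
    finally have "r\<^sup>2 \<le> 2 / pi * (C * (8 * pi) powr t1 * (8 * pi) powr t2 * pi powr t3 * r powr (t3 + (t1 + t2 + t3)))"
      by (simp add: field_simps)
    then show "r powr 2 \<le> (2 / pi * (C * (8 * pi) powr t1 * (8 * pi) powr t2 * pi powr t3)) * r powr (t3 + (t1 + t2 + t3))"
      using r by (simp add: mult.assoc)
  qed
  have "2 \<le> 2 * (t1 + t2 + t3)"
  proof (rule powr_le_imp_exponent_le)
    fix \<rho> :: real assume \<rho>: "0 < \<rho>" "\<rho> \<le> 1/2"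
    \<comment> \<open>Large radii are brought under the same comparison of powers by
      inversion.\<close>
    define r where "r = 1 / \<rho>"
    have r: "2 \<le> r" using \<rho> by (simp add: r_def field_simps)
    have "2 * (t1 + t2 + t3) = (t1 + t1) + (t2 + t2) + (t3 + t3)" by simp
    then have e: "r powr (2 * (t1 + t2 + t3)) = (r powr t1 * r powr t1) * (r powr t2 * r powr t2) * (r powr t3 * r powr t3)"
      by (simp only: powr_add)
    \<comment> \<open>A point of \<open>E r\<close> has norm at most \<open>1 + 2 * r\<close>, which
      is below \<open>4 * r\<close> here.\<close>
    have "emeasure lborel (E r) \<le> emeasure lborel (cball (0::real^2) (4 * r))"
      using r by (intro emeasure_mono) (auto simp: E_def)
    also have "\<dots> = ennreal (16 * pi * r\<^sup>2)" using r by (simp add: emeasure_cball unit_ball_vol_2 power_mult_distrib mult_ac)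
    finally have "pi * r\<^sup>2 / 2 \<le> C * (16 * pi * r\<^sup>2) powr t1 * (16 * pi * r\<^sup>2) powr t2 * (pi * r\<^sup>2) powr t3"
      using r by (intro key) auto
    also have "\<dots> = C * (16 * pi) powr t1 * (16 * pi) powr t2 * pi powr t3 * r powr (2 * (t1 + t2 + t3))"
      unfolding e using r by (simp add: powr_mult power2_eq_square)
    finally have "r\<^sup>2 \<le> 2 / pi * (C * (16 * pi) powr t1 * (16 * pi) powr t2 * pi powr t3 * r powr (2 * (t1 + t2 + t3)))"
      by (simp add: field_simps)
    moreover have "r\<^sup>2 = 1 / \<rho> powr 2" "r powr (2 * (t1 + t2 + t3)) = 1 / \<rho> powr (2 * (t1 + t2 + t3))"
      using \<rho> by (simp_all add: r_def power_divide powr_divide)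
    ultimately have le: "1 / \<rho> powr 2
        \<le> (2 / pi * (C * (16 * pi) powr t1 * (16 * pi) powr t2 * pi powr t3)) * (1 / \<rho> powr (2 * (t1 + t2 + t3)))"
      by (simp only: mult.assoc)
    have "y \<le> P * x" if "1 / x \<le> P * (1 / y)" "0 < x" "0 < y" for x y P :: real
      using that by (simp add: field_simps)
    from this[OF le] show "\<rho> powr (2 * (t1 + t2 + t3))
        \<le> (2 / pi * (C * (16 * pi) powr t1 * (16 * pi) powr t2 * pi powr t3)) * \<rho> powr 2"
      using \<rho> by simp
  qed
  then show "1 \<le> t1 + t2 + t3" by simp
qed

section \<open>The polytope described by its facet inequalities\<close>

lemma convex_four:
  fixes p q r s :: "'a::real_vector"
  assumes "convex T" "p \<in> T" "q \<in> T" "r \<in> T" "s \<in> T"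
    and "0 \<le> a" "0 \<le> b" "0 \<le> c" "0 \<le> d" "a + b + c + d = 1"
  shows "a *\<^sub>R p + b *\<^sub>R q + c *\<^sub>R r + d *\<^sub>R s \<in> T"
proof -
  have "(\<Sum>i<4. [a, b, c, d] ! i *\<^sub>R [p, q, r, s] ! i) \<in> T"
    using assms by (intro convex_sum) (auto simp: numeral_eq_Suc less_Suc_eq)
  then show ?thesis by (simp add: numeral_eq_Suc)
qed

text \<open>Explicit barycentric coordinates when \<open>c\<close> is the smallest entry. The region
  splits along \<open>a + b = 1\<close> into two simplices sharing (1,0,0), (0,1,0) and
  (1/2,1/2,1/2), the fourth vertex being (2/3,2/3,0) or (0,0,1). In the first the facet inequalities
  are the nonnegativity of two weights; in the second \<open>c \<le> a\<close> and
  \<open>c \<le> b\<close> provide it.\<close>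

lemma polytope_subset_convex_aux:
  fixes T :: "(real \<times> real \<times> real) set"
  assumes T: "convex T"
    and V: "{(1,0,0), (0,1,0), (0,0,1), (2/3,2/3,0), (2/3,0,2/3), (0,2/3,2/3), (1/2,1/2,1/2)} \<subseteq> T"
    and t: "0 \<le> c" "c \<le> a" "c \<le> b"
    and "1 \<le> a + b + c" "a + (a + b + c) \<le> 2" "b + (a + b + c) \<le> 2"
  shows "(a, b, c) \<in> T"
proof (cases "1 \<le> a + b")
  case True
  have "(2 - (b + (a + b + c))) *\<^sub>R (1, 0, 0) + (2 - (a + (a + b + c))) *\<^sub>R (0, 1, 0)
      + (3 * (a + b - 1)) *\<^sub>R (2/3, 2/3, 0) + (2 * c) *\<^sub>R (1/2, 1/2, 1/2) \<in> T"
    using True assms by (intro convex_four) auto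
  then show ?thesis by (simp add: algebra_simps)
next
  case False
  have "(1 - b - c) *\<^sub>R (1, 0, 0) + (1 - a - c) *\<^sub>R (0, 1, 0)
      + (1 - a - b) *\<^sub>R (0, 0, 1) + (2 * (a + b + c - 1)) *\<^sub>R (1/2, 1/2, 1/2) \<in> T"
    using False assms by (intro convex_four) auto
  then show ?thesis by (simp add: algebra_simps)
qed

lemma mem_triangle_polytopeI:
  assumes "0 \<le> a" "0 \<le> b" "0 \<le> c" "1 \<le> a + b + c"
    "a + (a + b + c) \<le> 2" "b + (a + b + c) \<le> 2" "c + (a + b + c) \<le> 2"
  shows "(a, b, c) \<in> triangle_polytope"
proof -
  let ?V = "{(1,0,0), (0,1,0), (0,0,1), (2/3,2/3,0), (2/3,0,2/3), (0,2/3,2/3), (1/2,1/2,1/2)} :: (real \<times> real \<times> real) set"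
  have V: "?V \<subseteq> triangle_polytope" unfolding triangle_polytope_def by (rule hull_subset)
  have T: "convex triangle_polytope" unfolding triangle_polytope_def by (rule convex_convex_hull)
  \<comment> \<open>Permuted copies of the polytope, which contain the same seven points; they move
    the smallest coordinate to the last place.\<close>
  define T1 where "T1 = {(x, y, z). (z, y, x) \<in> triangle_polytope}"
  define T2 where "T2 = {(x, y, z). (x, z, y) \<in> triangle_polytope}"
  have T12: "convex T1" "convex T2"
    using T unfolding convex_def T1_def T2_def by force+
  have V12: "?V \<subseteq> T1" "?V \<subseteq> T2" using V by (auto simp: T1_def T2_def)
  consider "c \<le> a" "c \<le> b" | "a \<le> b" "a \<le> c" | "b \<le> a" "b \<le> c" by linarith
  then show ?thesis
  proof cases
    case 1
    then show ?thesis using assms by (intro polytope_subset_convex_aux[OF T V]) auto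
  next
    case 2
    then have "(c, b, a) \<in> T1" using assms by (intro polytope_subset_convex_aux[OF T12(1) V12(1)]) auto
    then show ?thesis by (simp add: T1_def)
  next
    case 3
    then have "(a, c, b) \<in> T2" using assms by (intro polytope_subset_convex_aux[OF T12(2) V12(2)]) auto
    then show ?thesis by (simp add: T2_def)
  qed
qed

theorem theorem1p6:
  shows "(\<forall>t1 t2 t3. (t1, t2, t3) \<in> triangle_polytope - {(1/2, 1/2, 1/2)} \<longrightarrow>
            (\<exists>C::real. \<forall>f1 f2 f3. nonneg_meas f1 \<and> nonneg_meas f2 \<and> nonneg_meas f3 \<longrightarrow>
               Lambda_sup f1 f2 f3
                 \<le> ennreal C * Lp_norm t1 f1 * Lp_norm t2 f2 * Lp_norm t3 f3))
       \<and> (\<exists>C::real. \<forall>E1 E2 E3.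
               E1 \<in> sets lebesgue \<and> E2 \<in> sets lebesgue \<and> E3 \<in> sets lebesgue \<and>
               emeasure lebesgue E1 < \<infinity> \<and> emeasure lebesgue E2 < \<infinity> \<and>
               emeasure lebesgue E3 < \<infinity> \<longrightarrow>
               Lambda_sup (indicator E1) (indicator E2) (indicator E3)
                 \<le> ennreal C * Lp_norm (1/2) (indicator E1) * Lp_norm (1/2) (indicator E2)
                    * Lp_norm (1/2) (indicator E3))
       \<and> (\<forall>t1 t2 t3. t1 \<in> {0..1} \<and> t2 \<in> {0..1} \<and> t3 \<in> {0..1} \<and>
            (t1, t2, t3) \<notin> triangle_polytope \<longrightarrow>
            \<not> (\<exists>C::real. \<forall>f1 f2 f3. nonneg_meas f1 \<and> nonneg_meas f2 \<and> nonneg_meas f3 \<longrightarrow>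
               Lambda_inf f1 f2 f3
                 \<le> ennreal C * Lp_norm t1 f1 * Lp_norm t2 f2 * Lp_norm t3 f3))"
proof (intro conjI allI impI)
  fix t1 t2 t3
  assume "(t1, t2, t3) \<in> triangle_polytope - {(1/2, 1/2, 1/2)}"
  then show "\<exists>C::real. \<forall>f1 f2 f3. nonneg_meas f1 \<and> nonneg_meas f2 \<and> nonneg_meas f3 \<longrightarrow>
      Lambda_sup f1 f2 f3 \<le> ennreal C * Lp_norm t1 f1 * Lp_norm t2 f2 * Lp_norm t3 f3"
    using triangle_polytope_subset_bounded_exponents by (intro Lambda_sup_le_of_bounded_exponents) auto
next
  have ind: "nonneg_meas (indicator E)" if "E \<in> sets lebesgue" for E :: "(real^2) set"
    using that by (simp add: nonneg_meas_def borel_measurable_indicator)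
  \<comment> \<open>The restricted estimate is the strong bound at this vertex, specialized to
    indicators.\<close>
  obtain C where "\<forall>f1 f2 f3. nonneg_meas f1 \<and> nonneg_meas f2 \<and> nonneg_meas f3 \<longrightarrow>
      Lambda_sup f1 f2 f3 \<le> ennreal C * Lp_norm (1/2) f1 * Lp_norm (1/2) f2 * Lp_norm (1/2) f3"
    using Lambda_sup_le_of_bounded_exponents[OF bounded_exponents_half] by blast
  then show "\<exists>C::real. \<forall>E1 E2 E3.
               E1 \<in> sets lebesgue \<and> E2 \<in> sets lebesgue \<and> E3 \<in> sets lebesgue \<and>
               emeasure lebesgue E1 < \<infinity> \<and> emeasure lebesgue E2 < \<infinity> \<and>
               emeasure lebesgue E3 < \<infinity> \<longrightarrow>
               Lambda_sup (indicator E1) (indicator E2) (indicator E3)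
                 \<le> ennreal C * Lp_norm (1/2) (indicator E1) * Lp_norm (1/2) (indicator E2)
                    * Lp_norm (1/2) (indicator E3)"
    using ind by (intro exI[of _ C]) blast
next
  fix t1 t2 t3 :: real
  assume t: "t1 \<in> {0..1} \<and> t2 \<in> {0..1} \<and> t3 \<in> {0..1} \<and> (t1, t2, t3) \<notin> triangle_polytope"
  show "\<not> (\<exists>C::real. \<forall>f1 f2 f3. nonneg_meas f1 \<and> nonneg_meas f2 \<and> nonneg_meas f3 \<longrightarrow>
      Lambda_inf f1 f2 f3 \<le> ennreal C * Lp_norm t1 f1 * Lp_norm t2 f2 * Lp_norm t3 f3)"
  proof
    assume "\<exists>C::real. \<forall>f1 f2 f3. nonneg_meas f1 \<and> nonneg_meas f2 \<and> nonneg_meas f3 \<longrightarrow>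
      Lambda_inf f1 f2 f3 \<le> ennreal C * Lp_norm t1 f1 * Lp_norm t2 f2 * Lp_norm t3 f3"
    then obtain C where C: "\<And>f1 f2 f3. nonneg_meas f1 \<Longrightarrow> nonneg_meas f2 \<Longrightarrow> nonneg_meas f3 \<Longrightarrow>
      Lambda_inf f1 f2 f3 \<le> ennreal C * Lp_norm t1 f1 * Lp_norm t2 f2 * Lp_norm t3 f3" by blast
    have "nonneg_meas (indicator E)" if "E \<in> sets borel" for E :: "(real^2) set"
      using that by (auto simp: nonneg_meas_def intro!: measurable_completion)
    with C have b: "indicator_bounded t1 t2 t3"
      unfolding indicator_bounded_def by (intro exI[of _ C]) auto
    have "1 \<le> t1 + t2 + t3" "t3 + (t1 + t2 + t3) \<le> 2"
      using indicator_bounded_necessary[OF b] t by auto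
    \<comment> \<open>The test sets single out the exponent of the ball; placing the ball in another
      argument gives the facets for \<open>t2\<close> and \<open>t1\<close>.\<close>
    moreover have "t2 + (t1 + t2 + t3) \<le> 2"
      using indicator_bounded_necessary(2)[OF indicator_bounded_swap23[OF b]] t by auto
    moreover have "t1 + (t1 + t2 + t3) \<le> 2"
      using indicator_bounded_necessary(2)[OF indicator_bounded_swap23[OF indicator_bounded_swap12[OF b]]] t by auto
    ultimately have "(t1, t2, t3) \<in> triangle_polytope"
      using t by (intro mem_triangle_polytopeI) auto
    then show False using t by simp
  qed
qed

end
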